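(* Let $X_{Qdl}$ be the standard Borel space of quandles with underlying set $\mathbb{N}$, and let $\sqsubseteq_{Qdl}$ be the embeddability relation on $X_{Qdl}$. Then $\sqsubseteq_{Qdl}$ is a complete $\boldsymbol{\Sigma}^1_1$ quasi-order: it is an analytic quasi-order on $X_{Qdl}$, and for every analytic quasi-order $R$ on a standard Borel space $Y$ there is a Borel map $g\colon Y\to X_{Qdl}$ such that for all $x,y\in Y$, $x\mathrel{R}y \iff g(x)\sqsubseteq_{Qdl} g(y)$.
   Context: A quandle is a set $Q$ with a binary operation $\ast$ such that (a) $x\ast(y\ast z)=(x\ast y)\ast(x\ast z)$ for all $x,y,z$; (b) for all $x,z$ there is a unique $y$ with $x\ast y=z$; (c) $x\ast x=x$ for all $x$. $X_{Qdl}$ is the set of quandle operations on $\mathbb{N}$, viewed (via the graph of the operation) as a $G_\delta$ subset of $2^{\mathbb{N}^3}$ with the induced Polish topology and Borel structure. An embedding of quandles $Q\to Q'$ is an injective map $\theta$ with $\theta(a\ast b)=\theta(a)\ast'\theta(b)$; $Q\sqsubseteq_{Qdl}Q'$ means such an embedding exists. A quasi-order is a reflexive transitive relation; it is analytic if it is an analytic subset of the square of the space. *)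

theory Defs
  imports "HOL-Analysis.Analysis"
begin

section \<open>Standard Borel spaces and analytic sets\<close>

definition polish_topology :: "'a topology \<Rightarrow> bool" where
  "polish_topology T \<longleftrightarrow> separable_space T \<and> completely_metrizable_space T"

definition borel_of :: "'a topology \<Rightarrow> 'a measure" where
  "borel_of T = sigma (topspace T) {U. openin T U}"

lemma space_borel_of: "space (borel_of T) = topspace T"
  unfolding borel_of_def by (rule space_measure_of) (auto dest: openin_subset)

lemma sets_borel_of: "sets (borel_of T) = sigma_sets (topspace T) {U. openin T U}"
  unfolding borel_of_def by (rule sets_measure_of) (auto dest: openin_subset)

text \<open>Only the underlying measurable space of \<open>M\<close> matters here: equality of the sigma-algebras
  (which forces equality of the underlying sets) is required, the measure itself is ignored.\<close>

definition standard_borel :: "'a measure \<Rightarrow> bool" where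
  "standard_borel M \<longleftrightarrow> (\<exists>T. polish_topology T \<and> sets M = sets (borel_of T))"

text \<open>A subset of a Polish space is analytic if it is a continuous image of some (possibly empty)
  Polish space. A Polish space has at most continuum many points, so up to homeomorphism every
  Polish space is carried by a subset of the type \<open>nat \<Rightarrow> nat\<close>; hence no generality is lost by
  letting \<open>S\<close> range over all Polish topologies on subsets of this type.\<close>

definition analytic_in_topology :: "'a topology \<Rightarrow> 'a set \<Rightarrow> bool" where
  "analytic_in_topology T A \<longleftrightarrow>
     (\<exists>(S :: (nat \<Rightarrow> nat) topology) f.
        polish_topology S \<and> continuous_map S T f \<and> A = f ` topspace S)"

text \<open>In a standard Borel space, analyticity refers to a Polish topology inducing the Borel
  structure; it does not depend on which one.\<close>

definition analytic_in :: "'a measure \<Rightarrow> 'a set \<Rightarrow> bool" where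
  "analytic_in M A \<longleftrightarrow>
     (\<exists>T. polish_topology T \<and> sets M = sets (borel_of T) \<and> analytic_in_topology T A)"

definition analytic_quasi_order_on :: "'a measure \<Rightarrow> ('a \<times> 'a) set \<Rightarrow> bool" where
  "analytic_quasi_order_on M R \<longleftrightarrow> preorder_on (space M) R \<and> analytic_in (M \<Otimes>\<^sub>M M) R"

section \<open>Quandles\<close>

locale quandle =
  fixes Q :: "'a set" and op :: "'a \<Rightarrow> 'a \<Rightarrow> 'a"
  assumes closed: "\<And>x y. x \<in> Q \<Longrightarrow> y \<in> Q \<Longrightarrow> op x y \<in> Q"
    and left_distrib: "\<And>x y z. x \<in> Q \<Longrightarrow> y \<in> Q \<Longrightarrow> z \<in> Q \<Longrightarrow> op x (op y z) = op (op x y) (op x z)"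
    and left_div: "\<And>x z. x \<in> Q \<Longrightarrow> z \<in> Q \<Longrightarrow> \<exists>!y. y \<in> Q \<and> op x y = z"
    and idem: "\<And>x. x \<in> Q \<Longrightarrow> op x x = x"

definition quandle_embedding ::
  "'a set \<Rightarrow> ('a \<Rightarrow> 'a \<Rightarrow> 'a) \<Rightarrow> 'b set \<Rightarrow> ('b \<Rightarrow> 'b \<Rightarrow> 'b) \<Rightarrow> ('a \<Rightarrow> 'b) \<Rightarrow> bool" where
  "quandle_embedding Q op Q' op' \<theta> \<longleftrightarrow>
     \<theta> ` Q \<subseteq> Q' \<and> inj_on \<theta> Q \<and> (\<forall>a\<in>Q. \<forall>b\<in>Q. \<theta> (op a b) = op' (\<theta> a) (\<theta> b))"

definition op_graph :: "(nat \<Rightarrow> nat \<Rightarrow> nat) \<Rightarrow> (nat \<times> nat \<times> nat \<Rightarrow> bool)" where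
  "op_graph op = (\<lambda>(x, y, z). op x y = z)"

text \<open>The topology on \<open>nat \<times> nat \<times> nat \<Rightarrow> bool\<close> is the product topology with \<open>bool\<close> discrete. The map
  \<open>op_graph\<close> is injective, so pulling back along it is the same as identifying a quandle operation
  with its graph and taking the subspace topology.\<close>

definition X_Qdl_topology :: "(nat \<Rightarrow> nat \<Rightarrow> nat) topology" where
  "X_Qdl_topology = pullback_topology {op. quandle UNIV op} op_graph euclidean"

definition X_Qdl :: "(nat \<Rightarrow> nat \<Rightarrow> nat) measure" where
  "X_Qdl = borel_of X_Qdl_topology"

lemma space_X_Qdl: "space X_Qdl = {op. quandle UNIV op}"
  by (simp add: X_Qdl_def X_Qdl_topology_def space_borel_of topspace_pullback_topology)

definition qdl_embeddable :: "((nat \<Rightarrow> nat \<Rightarrow> nat) \<times> (nat \<Rightarrow> nat \<Rightarrow> nat)) set" where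
  "qdl_embeddable =
     {(p, q). p \<in> space X_Qdl \<and> q \<in> space X_Qdl \<and> (\<exists>\<theta>. quandle_embedding UNIV p UNIV q \<theta>)}"

end

theory Submission
  imports Defs
begin

text \<open>An irreflexive digraph \<open>E\<close> on \<open>V\<close> in which every vertex has an in-edge yields a quandle on
  \<open>V \<times> bool\<close> by \<open>(v, i) * (w, j) = (w, j + E v w)\<close>, and the embeddings between such quandles are
  induced by the embeddings of the digraphs.

  Let \<open>R\<close> be a transitive relation on the Baire space that is the projection of a closed set \<open>C\<close>. The
  digraph of a point \<open>x\<close> has a rigid chain, whose vertices serve as colours, and a vertex \<open>(n, s)\<close>
  for each formal path \<open>s\<close> of steps, a step being a triple of prefixes. The vertex is coloured by
  \<open>u\<close> iff \<open>s\<close> is a path of length-\<open>n\<close> prefixes of triples in \<open>C\<close> leading from \<open>u\<close> to the prefix of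
  \<open>x\<close>. If \<open>(x, c, y) \<in> C\<close>, then appending the corresponding step at each level is an embedding.
  Conversely, an embedding maps the empty paths to a coherent sequence of paths from the prefixes of
  \<open>x\<close> to those of \<open>y\<close>, and in the limit \<open>x\<close> and \<open>y\<close> are joined by a finite \<open>R\<close>-chain. Using formal
  paths replaces the usual normal trees, which are closed under sums of the witnesses, and makes the
  map on vertices injective for free.

  A general analytic quasi-order is moved into the Baire space by a Borel injection; the image is a
  projection of a closed set because Borel sets are Souslin sets.\<close>

section \<open>Quandles from digraphs\<close>

definition digraph_op :: "('v \<Rightarrow> 'v \<Rightarrow> bool) \<Rightarrow> 'v \<times> bool \<Rightarrow> 'v \<times> bool \<Rightarrow> 'v \<times> bool" where
  "digraph_op E p q = (fst q, snd q \<noteq> E (fst p) (fst q))"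

text \<open>Each left translation fixes the first coordinate, flips or keeps the second, and depends
  only on the first coordinate of the acting element. So the translations are commuting involutions,
  which gives distributivity and unique division; irreflexivity gives idempotence.\<close>

lemma quandle_digraph_op:
  assumes "\<And>v. \<not> E v v"
  shows "quandle UNIV (digraph_op E)"
proof
  fix x z :: "'a \<times> bool"
  show "\<exists>!y. y \<in> UNIV \<and> digraph_op E x y = z"
    by (rule ex1I[of _ "digraph_op E x z"]) (auto simp: digraph_op_def prod_eq_iff)
qed (use assms in \<open>auto simp: digraph_op_def prod_eq_iff\<close>)

lemma digraph_embedding_imp_quandle_embedding:
  assumes "inj a" and "\<And>v w. F (a v) (a w) \<longleftrightarrow> E v w"
  shows "quandle_embedding UNIV (digraph_op E) UNIV (digraph_op F) (map_prod a id)"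
  using assms by (auto simp: quandle_embedding_def digraph_op_def prod.inj_map)

text \<open>The quandle moves \<open>(w, j)\<close> exactly when \<open>w\<close> has an in-edge, and then its orbit is
  \<open>{w} \<times> UNIV\<close>; so an embedding maps these two-element fibres to fibres.\<close>

lemma quandle_embedding_imp_digraph_embedding:
  assumes emb: "quandle_embedding UNIV (digraph_op E) UNIV (digraph_op F) \<theta>"
    and in_edge: "\<And>w. \<exists>v. E v w"
  shows "\<exists>a. inj a \<and> (\<forall>v w. F (a v) (a w) \<longleftrightarrow> E v w)"
proof -
  have inj: "inj \<theta>" and hom: "\<And>p q. \<theta> (digraph_op E p q) = digraph_op F (\<theta> p) (\<theta> q)"
    using emb by (auto simp: quandle_embedding_def)
  define a where "a v = fst (\<theta> (v, False))" for v
  have a: "fst (\<theta> (w, j)) = a w" for w j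
  proof -
    obtain v where "E v w" using in_edge by blast
    then have "\<theta> (w, True) = digraph_op F (\<theta> (v, False)) (\<theta> (w, False))"
      using hom[of "(v, False)" "(w, False)"] by (simp add: digraph_op_def)
    then show ?thesis
      by (cases j) (simp_all add: a_def digraph_op_def)
  qed
  have snd: "snd (\<theta> (w, True)) \<noteq> snd (\<theta> (w, False))" for w
  proof
    assume "snd (\<theta> (w, True)) = snd (\<theta> (w, False))"
    then have "\<theta> (w, True) = \<theta> (w, False)"
      by (simp add: prod_eq_iff a)
    then show False
      using inj by (auto dest: injD)
  qed
  have "inj a"
  proof (rule injI)
    fix v w assume vw: "a v = a w"
    \<comment> \<open>Over \<open>w\<close> the second coordinates of the images take both truth
      values, so one point of that fibre has the same image as \<open>(v, False)\<close>.\<close>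
    obtain j where "snd (\<theta> (v, False)) = snd (\<theta> (w, j))"
      using snd[of w] by (metis (full_types))
    then have "\<theta> (v, False) = \<theta> (w, j)"
      by (simp add: prod_eq_iff a vw)
    then show "v = w" using inj by (auto dest: injD)
  qed
  \<comment> \<open>\<open>(v, False)\<close> moves \<open>(w, False)\<close> exactly along an edge,
    and the two images over \<open>w\<close> differ in the second coordinate, so the image is moved
    in exactly the same case.\<close>
  moreover have "F (a v) (a w) \<longleftrightarrow> E v w" for v w
    using hom[of "(v, False)" "(w, False)"] snd[of w]
    by (cases "E v w") (auto simp: digraph_op_def prod_eq_iff a)
  ultimately show ?thesis by blast
qed

section \<open>Transport of quandle operations along a bijection\<close>

definition transport_op :: "('a \<Rightarrow> 'b) \<Rightarrow> ('a \<Rightarrow> 'a \<Rightarrow> 'a) \<Rightarrow> 'b \<Rightarrow> 'b \<Rightarrow> 'b" where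
  "transport_op h op x y = h (op (inv h x) (inv h y))"

lemma quandle_transport_op:
  assumes h: "bij h" and op: "quandle UNIV op"
  shows "quandle UNIV (transport_op h op)"
proof -
  interpret quandle UNIV op by fact
  have [simp]: "inv h (h x) = x" "h (inv h y) = y" for x y
    using h by (simp_all add: bij_is_inj bij_is_surj surj_f_inv_f)
  show ?thesis
  proof
    fix x z :: 'b
    obtain y where y: "op (inv h x) y = inv h z" "\<And>y'. op (inv h x) y' = inv h z \<Longrightarrow> y' = y"
      using left_div[of "inv h x" "inv h z"] by auto
    show "\<exists>!y. y \<in> UNIV \<and> transport_op h op x y = z"
    proof (rule ex1I[of _ "h y"])
      fix y' assume "y' \<in> UNIV \<and> transport_op h op x y' = z"
      then have "inv h y' = y" by (intro y(2)) (auto simp: transport_op_def)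
      then show "y' = h y" by auto
    qed (simp add: transport_op_def y)
  qed (simp_all add: transport_op_def idem, metis left_distrib UNIV_I)
qed

lemma quandle_embedding_transport_op_iff:
  assumes h: "bij h"
  shows "(\<exists>\<theta>. quandle_embedding UNIV (transport_op h p) UNIV (transport_op h q) \<theta>) \<longleftrightarrow>
    (\<exists>\<theta>. quandle_embedding UNIV p UNIV q \<theta>)"
proof -
  have [simp]: "inv h (h x) = x" "h (inv h y) = y" for x y
    using h by (simp_all add: bij_is_inj bij_is_surj surj_f_inv_f)
  have injs: "inj h" "inj (inv h)"
    using h by (auto simp: bij_is_inj bij_imp_bij_inv)
  show ?thesis
  proof (intro iffI; elim exE)
    fix \<theta> assume "quandle_embedding UNIV (transport_op h p) UNIV (transport_op h q) \<theta>"
    then have inj: "inj \<theta>" and hom: "\<And>x y. \<theta> (transport_op h p x y) = transport_op h q (\<theta> x) (\<theta> y)"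
      by (auto simp: quandle_embedding_def)
    have "inj (inv h \<circ> \<theta> \<circ> h)" by (intro inj_compose injs inj)
    moreover have "(inv h \<circ> \<theta> \<circ> h) (p x y) = q ((inv h \<circ> \<theta> \<circ> h) x) ((inv h \<circ> \<theta> \<circ> h) y)" for x y
      using hom[of "h x" "h y"] by (simp add: transport_op_def)
    ultimately show "\<exists>\<theta>. quandle_embedding UNIV p UNIV q \<theta>"
      unfolding quandle_embedding_def by (intro exI[of _ "inv h \<circ> \<theta> \<circ> h"]) simp
  next
    fix \<theta> assume "quandle_embedding UNIV p UNIV q \<theta>"
    then have inj: "inj \<theta>" and hom: "\<And>x y. \<theta> (p x y) = q (\<theta> x) (\<theta> y)"
      by (auto simp: quandle_embedding_def)
    have "inj (h \<circ> \<theta> \<circ> inv h)" by (intro inj_compose injs inj)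
    moreover have "(h \<circ> \<theta> \<circ> inv h) (transport_op h p x y) =
        transport_op h q ((h \<circ> \<theta> \<circ> inv h) x) ((h \<circ> \<theta> \<circ> inv h) y)" for x y
      by (simp add: transport_op_def hom)
    ultimately show "\<exists>\<theta>. quandle_embedding UNIV (transport_op h p) UNIV (transport_op h q) \<theta>"
      unfolding quandle_embedding_def by (intro exI[of _ "h \<circ> \<theta> \<circ> inv h"]) simp
  qed
qed

section \<open>The digraph coding a point\<close>

definition prefix :: "(nat \<Rightarrow> nat) \<Rightarrow> nat \<Rightarrow> nat list" where
  "prefix x n = map x [0..<n]"

lemma length_prefix [simp]: "length (prefix x n) = n"
  by (simp add: prefix_def)

lemma take_prefix [simp]: "take n (prefix x (Suc n)) = prefix x n"
  by (simp add: prefix_def)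

lemma prefix_eq_iff: "prefix x n = prefix y n \<longleftrightarrow> (\<forall>i<n. x i = y i)"
  by (auto simp: prefix_def)

lemma coherent_lists_obtain:
  assumes "\<And>n. length (b n) = n" and "\<And>n. take n (b (Suc n)) = b n"
  obtains z where "\<And>n. b n = prefix z n"
proof
  \<comment> \<open>The limit is read off diagonally: entry \<open>m\<close> first appears in the
    list of length \<open>Suc m\<close>.\<close>
  define z where "z m = b (Suc m) ! m" for m
  show "b n = prefix z n" for n
  proof (induction n)
    case (Suc n)
    have "b (Suc n) = take n (b (Suc n)) @ [b (Suc n) ! n]"
      using assms(1)[of "Suc n"] by (metis lessI take_Suc_conv_app_nth take_all order_refl)
    then show ?case by (simp add: assms Suc prefix_def z_def)
  qed (use assms(1)[of 0] in \<open>simp add: prefix_def\<close>)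
qed

text \<open>The components are meant as prefixes of a point, of a witness, and of a point related to
  the first one.\<close>

type_synonym step = "nat list \<times> nat list \<times> nat list"

text \<open>Every step list gives a node, whether or not it is a path. Thus the vertex set is the
  same for all points, and a point enters only through the edges from the chain to the
  nodes.\<close>

datatype vertex = Apex | Base | Chain nat | Node nat "step list"

instance vertex :: countable by countable_datatype

fun step_path :: "step set \<Rightarrow> nat list \<Rightarrow> nat list \<Rightarrow> step list \<Rightarrow> bool" where
  "step_path T u v [] \<longleftrightarrow> u = v"
| "step_path T u v ((a, c, b) # s) \<longleftrightarrow> u = a \<and> (a, c, b) \<in> T \<and> step_path T b v s"

lemma step_path_snoc: "step_path T u v (s @ [(w, c, w')]) \<longleftrightarrow> step_path T u w s \<and> (w, c, w') \<in> T \<and> w' = v"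
  by (induction T u v s rule: step_path.induct) auto

definition step_take :: "nat \<Rightarrow> step \<Rightarrow> step" where
  "step_take n = map_prod (take n) (map_prod (take n) (take n))"

text \<open>\<open>Apex\<close> and \<open>Base\<close> form the only 2-cycle and anchor the rest:
  together they give every vertex an in-edge, while \<open>Base\<close> starts the chain and
  receives an edge from each node. Edges between nodes lead from a truncated step list to the lists
  one level up that extend it, which forces an embedding to choose paths coherently.\<close>

fun edge :: "step set \<Rightarrow> (nat \<Rightarrow> nat) \<Rightarrow> vertex \<Rightarrow> vertex \<Rightarrow> bool" where
  "edge T x Apex w \<longleftrightarrow> w \<noteq> Apex"
| "edge T x Base w \<longleftrightarrow> w = Apex \<or> w = Chain 0"
| "edge T x (Chain i) (Chain j) \<longleftrightarrow> j = Suc i"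
| "edge T x (Chain i) (Node n s) \<longleftrightarrow> (\<exists>u. i = to_nat u \<and> length u = n \<and> step_path T u (prefix x n) s)"
| "edge T x (Node n s) (Node m t) \<longleftrightarrow> m = Suc n \<and> s = map (step_take n) t"
| "edge T x (Node n s) Base \<longleftrightarrow> True"
| "edge T x _ _ \<longleftrightarrow> False"

lemma edge_irrefl: "\<not> edge T x v v"
  by (cases v) auto

lemma edge_in: "\<exists>v. edge T x v w"
  by (cases w) (auto intro: exI[of _ Apex] exI[of _ Base])

lemma edge_Base_iff: "edge T x v Base \<longleftrightarrow> v = Apex \<or> (\<exists>n s. v = Node n s)"
  by (cases v) auto

lemma edge_2_cycle:
  assumes "edge T x v w" "edge T x w v"
  shows "v = Apex \<and> w = Base \<or> v = Base \<and> w = Apex"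
  using assms by (cases v; cases w) auto

text \<open>The unique 2-cycle is preserved as a set, and its points cannot be swapped since
  \<open>Apex\<close> has infinitely many out-neighbours and \<open>Base\<close> only two. With both
  fixed, nodes are recognised as the in-neighbours of \<open>Base\<close> other than
  \<open>Apex\<close>, and the chain is fixed step by step from its start at
  \<open>Base\<close>.\<close>

lemma digraph_embedding_fixes:
  assumes inj: "inj a" and hom: "\<And>v w. edge T y (a v) (a w) \<longleftrightarrow> edge T x v w"
  shows "a (Chain i) = Chain i" and "\<exists>m t. a (Node n s) = Node m t"
proof -
  have cyc: "a Apex = Apex \<and> a Base = Base \<or> a Apex = Base \<and> a Base = Apex"
    using hom[of Apex Base] hom[of Base Apex] edge_2_cycle[of T y "a Apex" "a Base"] by auto
  have "a Apex \<noteq> Base"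
  proof
    assume "a Apex = Base"
    then have "a (Chain k) \<in> {Apex, Chain 0}" for k
      using hom[of Apex "Chain k"] by simp
    then have "range (\<lambda>k. a (Chain k)) \<subseteq> {Apex, Chain 0}"
      by blast
    then have "finite (range (\<lambda>k. a (Chain k)))"
      using finite_subset by blast
    moreover have "inj (\<lambda>k. a (Chain k))"
      using inj by (auto intro!: injI dest: injD)
    ultimately show False
      using finite_imageD by blast
  qed
  then have [simp]: "a Apex = Apex" "a Base = Base"
    using cyc by auto
  have node: "(\<exists>m t. a v = Node m t) \<longleftrightarrow> (\<exists>m t. v = Node m t)" for v
  proof -
    have "edge T y (a v) Base \<longleftrightarrow> edge T x v Base"
      using hom[of v Base] by simp
    moreover have "a v = Apex \<longleftrightarrow> v = Apex"
      using inj by (metis \<open>a Apex = Apex\<close> injD)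
    ultimately show ?thesis
      unfolding edge_Base_iff by auto
  qed
  show "\<exists>m t. a (Node n s) = Node m t"
    using node by blast
  show "a (Chain i) = Chain i"
  proof (induction i)
    case 0
    show ?case
      using hom[of Base "Chain 0"] inj by (auto dest: injD[of a "Chain 0" Apex])
  next
    case (Suc i)
    then have "edge T y (Chain i) (a (Chain (Suc i)))"
      using hom[of "Chain i" "Chain (Suc i)"] by simp
    \<comment> \<open>The out-neighbours of \<open>Chain i\<close> are \<open>Chain (Suc i)\<close>
      and nodes, so excluding nodes leaves one choice.\<close>
    moreover have "\<nexists>m t. a (Chain (Suc i)) = Node m t"
      using node by blast
    ultimately show ?case
      by (cases "a (Chain (Suc i))") auto
  qed
qed

text \<open>The prefixes of all triples in \<open>C\<close>, so that a closed \<open>C\<close> is the set of branches.\<close>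

definition steps :: "((nat \<Rightarrow> nat) \<times> (nat \<Rightarrow> nat) \<times> (nat \<Rightarrow> nat)) set \<Rightarrow> step set" where
  "steps C = {(prefix x n, prefix c n, prefix y n) |x c y n. (x, c, y) \<in> C}"

lemma steps_length: "(u, c, v) \<in> steps C \<Longrightarrow> length c = length u \<and> length v = length u"
  by (auto simp: steps_def)

text \<open>The triple agrees with elements of \<open>C\<close> on ever longer prefixes, so it is a
  limit of elements of \<open>C\<close>.\<close>

lemma steps_closed:
  assumes "closed C" and steps: "\<And>n. (prefix x n, prefix c n, prefix y n) \<in> steps C"
  shows "(x, c, y) \<in> C"
proof -
  \<comment> \<open>A member of \<open>steps C\<close> could come from any level; comparing lengths
    shows that the level is \<open>n\<close>.\<close>
  have "\<exists>x' c' y'. (x', c', y') \<in> C \<and> prefix x n = prefix x' n \<and> prefix c n = prefix c' n \<and>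
      prefix y n = prefix y' n" for n
    using steps[of n] unfolding steps_def by (smt (verit) length_prefix mem_Collect_eq prod.inject)
  then obtain X K Y where XKY: "\<And>n. (X n, K n, Y n) \<in> C" "\<And>n. prefix x n = prefix (X n) n"
    "\<And>n. prefix c n = prefix (K n) n" "\<And>n. prefix y n = prefix (Y n) n"
    by metis
  have lim: "Z \<longlonglongrightarrow> z" if "\<And>n. prefix z n = prefix (Z n) n" for z :: "nat \<Rightarrow> nat" and Z
  proof -
    have "((\<lambda>n. Z n i) \<longlonglongrightarrow> z i)" for i
    proof (rule tendsto_eventually)
      show "\<forall>\<^sub>F n in sequentially. Z n i = z i"
        using that unfolding eventually_sequentially prefix_eq_iff by (metis Suc_le_lessD)
    qed
    then have "limitin (product_topology (\<lambda>_. euclidean) UNIV) Z z sequentially"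
      by (simp add: limitin_componentwise)
    then show ?thesis
      by (simp add: euclidean_product_topology)
  qed
  have "(\<lambda>n. (X n, K n, Y n)) \<longlonglongrightarrow> (x, c, y)"
    using XKY by (intro tendsto_Pair lim) auto
  with \<open>closed C\<close> XKY(1) show ?thesis
    by (rule closed_sequentially)
qed

text \<open>Truncation keeps the number of steps, so all the paths have the same length, and the
  induction is on it. The first steps converge to a triple \<open>(x, g, z)\<close> in
  \<open>C\<close>, and the remaining paths lead coherently from the prefixes of \<open>z\<close> to
  those of \<open>y\<close>. Length zero leaves \<open>x = y\<close>, and transitivity collapses the
  resulting finite chain.\<close>

lemma coherent_paths_imp_related:
  assumes "closed C" and R: "R = {(x, y). \<exists>c. (x, c, y) \<in> C}" and "trans R"
    and "\<And>n. step_path (steps C) (prefix x n) (prefix y n) (s n)"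
    and "\<And>n. s n = map (step_take n) (s (Suc n))"
  shows "x = y \<or> (x, y) \<in> R"
  using assms(4,5)
proof (induction "length (s 0)" arbitrary: s x)
  case 0
  have "length (s (Suc n)) = length (s n)" for n
    by (subst (2) 0(3)) simp
  then have "length (s n) = 0" for n
    using 0(1) by (induction n) simp_all
  then have "prefix x n = prefix y n" for n
    using 0(2)[of n] by simp
  then show ?case
    using prefix_eq_iff by (metis ext lessI)
next
  case (Suc k)
  have "length (s (Suc n)) = length (s n)" for n
    by (subst (2) Suc.prems(2)) simp
  then have len: "length (s n) = Suc k" for n
    using Suc.hyps(2) by (induction n) simp_all
  have "\<exists>c b t. s n = (prefix x n, c, b) # t" for n
    using len[of n] Suc.prems(1)[of n] by (cases "s n") auto
  then obtain c b t where s: "\<And>n. s n = (prefix x n, c n, b n) # t n"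
    by metis
  have step: "(prefix x n, c n, b n) \<in> steps C" and path: "step_path (steps C) (b n) (prefix y n) (t n)" for n
    using Suc.prems(1)[of n] by (auto simp: s)
  have coh: "take n (c (Suc n)) = c n" "take n (b (Suc n)) = b n" "t n = map (step_take n) (t (Suc n))" for n
    using Suc.prems(2)[of n] by (auto simp: s step_take_def)
  obtain z where z: "\<And>n. b n = prefix z n"
    using coherent_lists_obtain[of b] coh steps_length[OF step] by auto
  obtain g where g: "\<And>n. c n = prefix g n"
    using coherent_lists_obtain[of c] coh steps_length[OF step] by auto
  have "(x, g, z) \<in> C"
    using step by (intro steps_closed[OF \<open>closed C\<close>]) (simp add: z g)
  then have "(x, z) \<in> R"
    by (auto simp: R)
  moreover have "z = y \<or> (z, y) \<in> R"
  proof (rule Suc.hyps(1))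
    show "k = length (t 0)"
      using len[of 0] by (simp add: s)
    show "step_path (steps C) (prefix z n) (prefix y n) (t n)" for n
      using path[of n] by (simp add: z)
  qed (fact coh(3))
  ultimately show ?case
    using \<open>trans R\<close> by (auto dest: transD)
qed

text \<open>The empty list at level \<open>n\<close> is the trivial path at
  \<open>prefix x n\<close> and so has that colour. Its image keeps the colour, hence is a path from
  \<open>prefix x n\<close> to \<open>prefix y n\<close>, and the length of the colour forces level
  \<open>n\<close>. The edges between consecutive levels make these paths coherent.\<close>

lemma digraph_embedding_imp_related:
  assumes "closed C" and R: "R = {(x, y). \<exists>c. (x, c, y) \<in> C}" and "trans R"
    and inj: "inj a" and hom: "\<And>v w. edge (steps C) y (a v) (a w) \<longleftrightarrow> edge (steps C) x v w"
  shows "x = y \<or> (x, y) \<in> R"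
proof -
  note fixed = digraph_embedding_fixes[OF inj hom]
  have "\<exists>s. a (Node n []) = Node n s \<and> step_path (steps C) (prefix x n) (prefix y n) s" for n
  proof -
    obtain m t where mt: "a (Node n []) = Node m t"
      using fixed(2) by blast
    have "edge (steps C) x (Chain (to_nat (prefix x n))) (Node n [])"
      by simp
    then have "edge (steps C) y (Chain (to_nat (prefix x n))) (Node m t)"
      using hom[of "Chain (to_nat (prefix x n))" "Node n []"] unfolding fixed mt by iprover
    then obtain u where u: "to_nat (prefix x n) = to_nat u" "length u = m" "step_path (steps C) u (prefix y m) t"
      unfolding edge.simps by blast
    from u(1) have "u = prefix x n"
      by simp
    with u mt show ?thesis
      by auto
  qed
  then obtain s where s: "\<And>n. a (Node n []) = Node n (s n)"
    and path: "\<And>n. step_path (steps C) (prefix x n) (prefix y n) (s n)"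
    by metis
  have "s n = map (step_take n) (s (Suc n))" for n
    using hom[of "Node n []" "Node (Suc n) []"] by (simp add: s)
  with path show ?thesis
    using coherent_paths_imp_related[OF assms(1-3)] by blast
qed

text \<open>A step starting at the prefix of \<open>x\<close> can be appended exactly to the paths that end there,
  so appending it preserves and reflects the edges from the chain.\<close>

lemma related_imp_digraph_embedding:
  assumes C: "(x, c, y) \<in> C"
  obtains a where "inj a" and "\<And>v w. edge (steps C) y (a v) (a w) \<longleftrightarrow> edge (steps C) x v w"
proof
  define t where "t n = (prefix x n, prefix c n, prefix y n)" for n
  have t: "t n \<in> steps C" "step_take n (t (Suc n)) = t n" for n
    using C by (auto simp: t_def steps_def step_take_def)
  define a where "a v = (case v of Node n s \<Rightarrow> Node n (s @ [t n]) | _ \<Rightarrow> v)" for v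
  show "inj a"
    by (auto simp: inj_def a_def split: vertex.splits)
  show "edge (steps C) y (a v) (a w) \<longleftrightarrow> edge (steps C) x v w" for v w
    using t by (cases v; cases w) (auto simp: a_def step_path_snoc t_def)
qed

section \<open>The coded quandle on the natural numbers\<close>

definition vertex_code :: "vertex \<times> bool \<Rightarrow> nat" where
  "vertex_code = to_nat_on UNIV"

lemma bij_vertex_code: "bij vertex_code"
proof -
  have "inj (\<lambda>n. (Chain n, True))"
    by (auto intro: injI)
  then have "infinite (UNIV :: (vertex \<times> bool) set)"
    using finite_subset[OF subset_UNIV] range_inj_infinite by blast
  then show ?thesis
    unfolding vertex_code_def by (intro to_nat_on_infinite) auto
qed

definition coded_quandle :: "step set \<Rightarrow> (nat \<Rightarrow> nat) \<Rightarrow> nat \<Rightarrow> nat \<Rightarrow> nat" where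
  "coded_quandle T x = transport_op vertex_code (digraph_op (edge T x))"

lemma quandle_coded_quandle: "quandle UNIV (coded_quandle T x)"
  unfolding coded_quandle_def
  by (intro quandle_transport_op quandle_digraph_op bij_vertex_code edge_irrefl)

text \<open>Reflexivity at \<open>x\<close> absorbs the case \<open>x = y\<close>, which arises when
  an embedding yields a chain of length zero.\<close>

lemma coded_quandle_embeddable_iff:
  assumes "closed C" and R: "R = {(x, y). \<exists>c. (x, c, y) \<in> C}" and "trans R" and "(x, x) \<in> R"
  shows "(coded_quandle (steps C) x, coded_quandle (steps C) y) \<in> qdl_embeddable \<longleftrightarrow> (x, y) \<in> R"
proof -
  have "(coded_quandle (steps C) x, coded_quandle (steps C) y) \<in> qdl_embeddable \<longleftrightarrow>
    (\<exists>\<theta>. quandle_embedding UNIV (digraph_op (edge (steps C) x)) UNIV (digraph_op (edge (steps C) y)) \<theta>)"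
    using quandle_embedding_transport_op_iff[OF bij_vertex_code]
    by (simp add: qdl_embeddable_def space_X_Qdl quandle_coded_quandle)
      (simp add: coded_quandle_def)
  also have "\<dots> \<longleftrightarrow> (x, y) \<in> R"
  proof
    assume "\<exists>\<theta>. quandle_embedding UNIV (digraph_op (edge (steps C) x)) UNIV (digraph_op (edge (steps C) y)) \<theta>"
    then have "\<exists>a. inj a \<and> (\<forall>v w. edge (steps C) y (a v) (a w) \<longleftrightarrow> edge (steps C) x v w)"
      using quandle_embedding_imp_digraph_embedding[OF _ edge_in] by (elim exE)
    then obtain a where "inj a" "\<And>v w. edge (steps C) y (a v) (a w) \<longleftrightarrow> edge (steps C) x v w"
      by (elim exE conjE) auto
    then have "x = y \<or> (x, y) \<in> R"
      by (rule digraph_embedding_imp_related[OF assms(1-3)])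
    then show "(x, y) \<in> R"
      using \<open>(x, x) \<in> R\<close> by auto
  next
    assume "(x, y) \<in> R"
    then obtain c where "(x, c, y) \<in> C"
      by (auto simp: R)
    then obtain a where a: "inj a" "\<And>v w. edge (steps C) y (a v) (a w) \<longleftrightarrow> edge (steps C) x v w"
      by (rule related_imp_digraph_embedding) auto
    then have "quandle_embedding UNIV (digraph_op (edge (steps C) x)) UNIV (digraph_op (edge (steps C) y))
        (map_prod a id)"
      using digraph_embedding_imp_quandle_embedding[of a "edge (steps C) y" "edge (steps C) x"] by simp
    then show "\<exists>\<theta>. quandle_embedding UNIV (digraph_op (edge (steps C) x)) UNIV (digraph_op (edge (steps C) y)) \<theta>"
      by (rule exI[of _ "map_prod a id"])
  qed
  finally show ?thesis .
qed

text \<open>A single entry of the operation table depends on one edge, hence on at most one finite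
  prefix of the point: only an edge from the chain to a node of level \<open>n\<close> looks at the
  point, and it looks at \<open>prefix x n\<close>.\<close>

lemma coded_quandle_measurable:
  assumes x: "\<And>n. (\<lambda>y. x y n) \<in> measurable M (count_space UNIV)"
  shows "(\<lambda>y. coded_quandle T (x y) k l) \<in> measurable M (count_space UNIV)"
proof -
  have pre: "(\<lambda>y. prefix (x y) n) \<in> measurable M (count_space UNIV)" for n
  proof (induction n)
    case (Suc n)
    note [measurable] = Suc x
    show ?case
      unfolding prefix_def upt_Suc by (simp flip: prefix_def)
  qed (simp add: prefix_def)
  have "\<exists>n H. \<forall>z. coded_quandle T z k l = H (prefix z n)"
  proof -
    obtain v i w j where k: "inv vertex_code k = (v, i)" and l: "inv vertex_code l = (w, j)"
      by (metis surj_pair)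
    have "\<exists>n H. \<forall>z. edge T z v w = H (prefix z n)"
    proof (cases "\<exists>i n s. v = Chain i \<and> w = Node n s")
      case True
      then obtain i n s where "v = Chain i" "w = Node n s"
        by auto
      show ?thesis
        by (rule exI[of _ n], rule exI[of _ "\<lambda>p. \<exists>u. i = to_nat u \<and> length u = n \<and> step_path T u p s"])
          (simp add: \<open>v = Chain i\<close> \<open>w = Node n s\<close>)
    next
      case False
      \<comment> \<open>The zero sequence is an arbitrary representative, as these edges do not
        depend on the point.\<close>
      then have "\<forall>z. edge T z v w = edge T (\<lambda>_. 0) v w"
        by (cases v; cases w) simp_all
      then show ?thesis
        by (intro exI[of _ "0::nat"] exI[of _ "\<lambda>_::nat list. edge T (\<lambda>_. 0) v w"])
    qed
    then obtain n H where "\<And>z. edge T z v w = H (prefix z n)"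
      by metis
    then show ?thesis
      by (intro exI[of _ n] exI[of _ "\<lambda>u. vertex_code (w, j \<noteq> H u)"])
        (simp add: coded_quandle_def transport_op_def digraph_op_def k l)
  qed
  then obtain n H where "\<And>z. coded_quandle T z k l = H (prefix z n)"
    by metis
  then show ?thesis
    using measurable_compose[OF pre, of H] by simp
qed

section \<open>The space of quandles\<close>

lemma second_countable_euclidean: "second_countable (euclidean :: 'a::second_countable_topology topology)"
proof -
  obtain B :: "'a set set" where B: "countable B" "\<And>U. U \<in> B \<Longrightarrow> open U"
    "\<And>W. open W \<Longrightarrow> \<exists>\<U>. \<U> \<subseteq> B \<and> W = \<Union>\<U>"
    using univ_second_countable by blast
  have "\<exists>V\<in>B. x \<in> V \<and> V \<subseteq> W" if "open W" "x \<in> W" for W x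
    using B(3)[OF \<open>open W\<close>] \<open>x \<in> W\<close> by (metis Union_iff Union_upper subset_iff)
  with B(1,2) show ?thesis
    unfolding second_countable_def by (intro exI[of _ B]) simp
qed

lemma completely_metrizable_discrete:
  "completely_metrizable_space (euclidean :: 'a::discrete_topology topology)"
proof -
  have "(euclidean :: 'a topology) = discrete_topology UNIV"
    by (simp add: topology_eq open_discrete)
  then show ?thesis
    by (simp add: completely_metrizable_space_discrete_topology)
qed

lemma completely_metrizable_fun:
  assumes "completely_metrizable_space (euclidean :: 'b::topological_space topology)"
  shows "completely_metrizable_space (euclidean :: ('i::countable \<Rightarrow> 'b) topology)"
  using assms
    completely_metrizable_space_product_topology[of "\<lambda>_ :: 'i. euclidean :: 'b topology" UNIV]
  by (simp add: euclidean_product_topology)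

text \<open>By Alexandrov's theorem a G-delta subset of a completely metrizable space is completely
  metrizable; separability follows from second countability.\<close>

lemma polish_topology_gdelta:
  fixes S :: "'a::second_countable_topology set"
  assumes "completely_metrizable_space (euclidean :: 'a topology)" and "gdelta_in euclidean S"
  shows "polish_topology (top_of_set S)"
  using assms
  by (simp add: polish_topology_def second_countable_imp_separable_space second_countable_subtopology
      second_countable_euclidean completely_metrizable_space_gdelta_in)

lemma gdelta_in_Collect_conj:
  assumes "gdelta_in euclidean {x. P x}" "gdelta_in euclidean {x. Q x}"
  shows "gdelta_in euclidean {x. P x \<and> Q x}"
  using gdelta_in_Int[OF assms] by (simp add: Int_def)

lemma gdelta_in_Collect_all:
  fixes P :: "'i::countable \<Rightarrow> 'a::topological_space \<Rightarrow> bool"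
  assumes "\<And>i. gdelta_in euclidean {x. P i x}"
  shows "gdelta_in euclidean {x. \<forall>i. P i x}"
proof -
  have "gdelta_in euclidean (\<Inter>(range (\<lambda>i. {x. P i x})))"
    using assms by (intro gdelta_in_Inter) auto
  moreover have "\<Inter>(range (\<lambda>i. {x. P i x})) = {x. \<forall>i. P i x}"
    by auto
  ultimately show ?thesis
    by simp
qed

lemma gdelta_in_open: "open S \<Longrightarrow> gdelta_in euclidean S"
  by (simp add: open_imp_gdelta_in)

lemma open_Collect_discrete:
  fixes f :: "'a::topological_space \<Rightarrow> 'b::discrete_topology"
  assumes "continuous_on UNIV f"
  shows "open {x. P (f x)}"
  using open_vimage[OF open_discrete assms, of "Collect P"] by (simp add: vimage_def)

lemma open_Collect_discrete2:
  fixes f :: "'a::topological_space \<Rightarrow> 'b::discrete_topology" and g :: "'a \<Rightarrow> 'c::discrete_topology"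
  assumes f: "continuous_on UNIV f" and g: "continuous_on UNIV g"
  shows "open {x. P (f x) (g x)}"
proof -
  have "{x. P (f x) (g x)} = (\<Union>k. {x. f x = k} \<inter> {x. P k (g x)})"
    by auto
  moreover have "open \<dots>"
    by (intro open_UN ballI open_Int open_Collect_discrete f g)
  ultimately show ?thesis
    by simp
qed

text \<open>The index \<open>g x\<close> is locally constant, so locally the map evaluates
  \<open>f\<close> at a fixed coordinate. This makes nested products of operations continuous in the
  operation.\<close>

lemma continuous_on_apply_discrete:
  fixes f :: "'a::topological_space \<Rightarrow> 'i::discrete_topology \<Rightarrow> 'b::topological_space"
  assumes f: "continuous_on UNIV f" and g: "continuous_on UNIV g"
  shows "continuous_on UNIV (\<lambda>x. f x (g x))"
  unfolding continuous_on_open_vimage[OF open_UNIV]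
proof (intro allI impI)
  fix B :: "'b set" assume "open B"
  have "(\<lambda>x. f x (g x)) -` B \<inter> UNIV = (\<Union>k. {x. g x = k} \<inter> (\<lambda>x. f x k) -` B)"
    by auto
  moreover have "open ((\<lambda>x. f x k) -` B)" for k
    by (rule open_vimage[OF \<open>open B\<close> continuous_on_product_then_coordinatewise[OF f]])
  then have "open (\<Union>k. {x. g x = k} \<inter> (\<lambda>x. f x k) -` B)"
    by (intro open_UN ballI open_Int open_Collect_discrete g)
  ultimately show "open ((\<lambda>x. f x (g x)) -` B \<inter> UNIV)"
    by simp
qed

text \<open>Unique division is split into surjectivity and injectivity so that each conjunct becomes
  an open condition once its outer variables are fixed.\<close>

lemma quandle_UNIV_iff:
  "quandle UNIV op \<longleftrightarrow> (\<forall>x y z. op x (op y z) = op (op x y) (op x z)) \<and>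
     (\<forall>x z. \<exists>y. op x y = z) \<and> (\<forall>x y y'. op x y = op x y' \<longrightarrow> y = y') \<and> (\<forall>x. op x x = x)"
proof -
  have "(\<forall>x z. \<exists>!y. op x y = z) \<longleftrightarrow> (\<forall>x z. \<exists>y. op x y = z) \<and> (\<forall>x y y'. op x y = op x y' \<longrightarrow> y = y')"
    by metis
  then show ?thesis
    unfolding quandle_def by simp
qed

text \<open>Each axiom compares finitely many values in a discrete space, except for solvability,
  which is a union over the solution. The continuous family \<open>f\<close> allows operations coded
  inside a sequence.\<close>

lemma gdelta_quandle:
  fixes f :: "'a::topological_space \<Rightarrow> nat \<Rightarrow> nat \<Rightarrow> nat"
  assumes f: "continuous_on UNIV f"
  shows "gdelta_in euclidean {p. quandle UNIV (f p)}"
proof -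
  have fc: "continuous_on UNIV (\<lambda>p. f p (g p) (h p))"
    if "continuous_on UNIV g" "continuous_on UNIV h" for g h
    by (rule continuous_on_apply_discrete[OF continuous_on_apply_discrete[OF f that(1)] that(2)])
  note c = continuous_on_const
  have "open {p. \<exists>y. f p x y = z}" for x z
  proof -
    have "{p. \<exists>y. f p x y = z} = (\<Union>y. {p. f p x y = z})"
      by auto
    then show ?thesis
      using open_Collect_discrete[OF fc[OF c c], of "\<lambda>u. u = z" x] by (simp add: open_UN)
  qed
  then show ?thesis
    unfolding quandle_UNIV_iff
    using open_Collect_discrete2[where P = "(=)", OF fc[OF c fc[OF c c]] fc[OF fc[OF c c] fc[OF c c]]]
      open_Collect_discrete2[where P = "\<lambda>u v. u = v \<longrightarrow> y = y'" for y y', OF fc[OF c c] fc[OF c c]]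
      open_Collect_discrete[where P = "\<lambda>u. u = x" for x, OF fc[OF c c]]
    by (intro gdelta_in_Collect_conj gdelta_in_Collect_all gdelta_in_open) assumption+
qed

text \<open>On total operations the topology of graphs is that of pointwise convergence: one bit of
  the graph is decided by one value, and \<open>op x y \<in> U\<close> is the union over
  \<open>z \<in> U\<close> of the conditions that \<open>(x, y, z)\<close> lies in the
  graph.\<close>

lemma X_Qdl_topology_eq: "X_Qdl_topology = top_of_set {op. quandle UNIV op}"
proof -
  let ?Q = "{op :: nat \<Rightarrow> nat \<Rightarrow> nat. quandle UNIV op}"
  let ?T = "pullback_topology ?Q op_graph euclidean"
  have top: "topspace ?T = ?Q"
    by (simp add: topspace_pullback_topology)
  have "continuous_map ?T euclidean (id \<circ> op_graph)"
    by (rule continuous_map_pullback) (rule continuous_map_id)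
  then have graph: "continuous_map ?T euclidean op_graph"
    by (simp only: id_o)
  have "openin (top_of_set ?Q) U" if "openin ?T U" for U
  proof -
    have ev: "continuous_on UNIV (\<lambda>op :: nat \<Rightarrow> nat \<Rightarrow> nat. op x y)" for x y
      by (rule continuous_on_product_then_coordinatewise[OF continuous_on_product_coordinates[of x]])
    have "continuous_on UNIV (\<lambda>op. op x y = z)" for x y z :: nat
      using open_Collect_discrete[OF ev, of "\<lambda>u. (u = z) \<in> B" x y for B]
      by (simp add: continuous_on_open_vimage vimage_def)
    then have "continuous_on UNIV op_graph"
      by (intro continuous_on_coordinatewise_then_product) (auto simp: op_graph_def)
    then have "open (op_graph -` V)" if "open V" for V
      using that by (simp add: open_vimage)
    then show ?thesis
      using that by (auto simp: openin_pullback_topology openin_open)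
  qed
  moreover have "openin ?T U" if "openin (top_of_set ?Q) U" for U
  proof -
    have coord: "continuous_map ?T euclidean (\<lambda>op. op x y)" for x y :: nat
      unfolding continuous_map_def
    proof (intro conjI allI impI)
      fix U :: "nat set"
      have "continuous_map euclidean euclidean (\<lambda>r. r (x, y, z))" for z
        unfolding continuous_map_iff_continuous2 by (rule continuous_on_product_coordinates)
      then have "continuous_map ?T euclidean ((\<lambda>r. r (x, y, z)) \<circ> op_graph)" for z
        by (rule continuous_map_compose[OF graph])
      then have "continuous_map ?T euclidean (\<lambda>op. op_graph op (x, y, z))" for z
        by (simp only: o_def)
      then have "openin ?T {op \<in> topspace ?T. op_graph op (x, y, z) \<in> {True}}" for z
        by (rule openin_continuous_map_preimage) (simp add: open_discrete)
      then have "openin ?T (\<Union>z\<in>U. {op \<in> topspace ?T. op_graph op (x, y, z) \<in> {True}})"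
        by blast
      moreover have "(\<Union>z\<in>U. {op \<in> topspace ?T. op_graph op (x, y, z) \<in> {True}}) =
          {op \<in> topspace ?T. op x y \<in> U}"
        by (auto simp: op_graph_def)
      ultimately show "openin ?T {op \<in> topspace ?T. op x y \<in> U}"
        by simp
    qed auto
    note componentwise = continuous_map_componentwise_UNIV[where Y = "\<lambda>_. euclidean", unfolded euclidean_product_topology]
    have "continuous_map ?T euclidean (\<lambda>op. op x)" for x :: nat
      using coord componentwise[of ?T "\<lambda>op. op x"] by simp
    then have "continuous_map ?T euclidean (\<lambda>op. op)"
      using componentwise[of ?T "\<lambda>op. op"] by simp
    then have "openin ?T {op \<in> topspace ?T. op \<in> V}" if "open V" for V
      by (rule openin_continuous_map_preimage) (use that in simp)
    then show ?thesis
      using that by (auto simp: openin_open top Int_def)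
  qed
  ultimately show ?thesis
    unfolding X_Qdl_topology_def topology_eq by blast
qed

lemma polish_topology_X_Qdl: "polish_topology X_Qdl_topology"
  unfolding X_Qdl_topology_eq
  using gdelta_quandle[OF continuous_on_id] by (intro polish_topology_gdelta completely_metrizable_fun completely_metrizable_discrete) simp

lemma standard_borel_X_Qdl: "standard_borel X_Qdl"
  unfolding standard_borel_def X_Qdl_def using polish_topology_X_Qdl by blast

section \<open>Measurable maps and Borel structures of products\<close>

lemma measurable_borel_of:
  assumes "f \<in> space M \<rightarrow> topspace T" and "\<And>U. openin T U \<Longrightarrow> f -` U \<inter> space M \<in> sets M"
  shows "f \<in> measurable M (borel_of T)"
  unfolding borel_of_def by (rule measurable_measure_of) (use assms in \<open>auto dest: openin_subset\<close>)

lemma continuous_map_measurable: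
  assumes "continuous_map S T f"
  shows "f \<in> measurable (borel_of S) (borel_of T)"
proof (rule measurable_borel_of)
  fix U assume "openin T U"
  then have "openin S (f -` U \<inter> topspace S)"
    using openin_continuous_map_preimage[OF assms] by (simp add: vimage_def Int_def conj_commute)
  then show "f -` U \<inter> space (borel_of S) \<in> sets (borel_of S)"
    by (auto simp: sets_borel_of space_borel_of)
qed (use assms in \<open>auto simp: space_borel_of continuous_map_def\<close>)

lemma measurable_X_Qdl:
  assumes "\<And>y. y \<in> space M \<Longrightarrow> quandle UNIV (g y)"
    and "\<And>k l. (\<lambda>y. g y k l) \<in> measurable M (count_space UNIV)"
  shows "g \<in> measurable M X_Qdl"
  unfolding X_Qdl_def
proof (rule measurable_borel_of)
  have "(\<lambda>y. g y k l) \<in> borel_measurable M" for k l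
    using assms(2)[of k l] by (simp only: measurable_cong_sets[OF refl sets_borel_eq_count_space])
  then have "(\<lambda>y. g y k) \<in> borel_measurable M" for k
    by (rule measurable_coordinatewise_then_product)
  then have g: "g \<in> borel_measurable M"
    by (rule measurable_coordinatewise_then_product)
  show "g -` U \<inter> space M \<in> sets M" if "openin X_Qdl_topology U" for U
  proof -
    obtain V where "open V" "U = {op. quandle UNIV op} \<inter> V"
      using \<open>openin X_Qdl_topology U\<close> by (auto simp: X_Qdl_topology_eq openin_open)
    then have "g -` U \<inter> space M = g -` V \<inter> space M"
      using assms(1) by auto
    then show ?thesis
      using measurable_sets[OF g borel_open[OF \<open>open V\<close>]] by simp
  qed
qed (use assms(1) in \<open>auto simp: X_Qdl_topology_eq\<close>)

text \<open>The rectangles are products of members of two countable bases. They are kept as pairs of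
  sides so that the openness of each side stays available.\<close>

lemma openin_prod_countable_Union:
  assumes "second_countable A" "second_countable B"
  obtains \<R> where "countable \<R>" and "\<And>U V. (U, V) \<in> \<R> \<Longrightarrow> openin A U \<and> openin B V"
    and "\<And>W p. openin (prod_topology A B) W \<Longrightarrow> p \<in> W \<Longrightarrow> \<exists>(U, V)\<in>\<R>. p \<in> U \<times> V \<and> U \<times> V \<subseteq> W"
proof -
  obtain \<A> where \<A>: "countable \<A>" "\<And>U. U \<in> \<A> \<Longrightarrow> openin A U"
    "\<And>W x. openin A W \<and> x \<in> W \<longrightarrow> (\<exists>U\<in>\<A>. x \<in> U \<and> U \<subseteq> W)"
    using assms(1) by (auto simp: second_countable_def)
  obtain \<B> where \<B>: "countable \<B>" "\<And>U. U \<in> \<B> \<Longrightarrow> openin B U"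
    "\<And>W x. openin B W \<and> x \<in> W \<longrightarrow> (\<exists>U\<in>\<B>. x \<in> U \<and> U \<subseteq> W)"
    using assms(2) by (auto simp: second_countable_def)
  show thesis
  proof
    show "countable (\<A> \<times> \<B>)"
      using \<A>(1) \<B>(1) by simp
  next
    fix W p assume W: "openin (prod_topology A B) W" "p \<in> W"
    obtain x y where p: "p = (x, y)"
      by (cases p)
    obtain U V where "openin A U" "openin B V" "x \<in> U" "y \<in> V" "U \<times> V \<subseteq> W"
      using W(1)[unfolded openin_prod_topology_alt, rule_format, of x y] W(2) unfolding p by metis
    moreover from this obtain U' V' where "U' \<in> \<A>" "x \<in> U'" "U' \<subseteq> U" "V' \<in> \<B>" "y \<in> V'" "V' \<subseteq> V"
      using \<A>(3) \<B>(3) by meson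
    ultimately have "(U', V') \<in> \<A> \<times> \<B>" "p \<in> U' \<times> V'" "U' \<times> V' \<subseteq> W"
      by (auto simp: p)
    then show "\<exists>(U, V)\<in>\<A> \<times> \<B>. p \<in> U \<times> V \<and> U \<times> V \<subseteq> W"
      by blast
  qed (use \<A>(2) \<B>(2) in auto)
qed

lemma second_countable_prod_topology:
  assumes "second_countable A" "second_countable B"
  shows "second_countable (prod_topology A B)"
proof -
  obtain \<R> where \<R>: "countable \<R>" "\<And>U V. (U, V) \<in> \<R> \<Longrightarrow> openin A U \<and> openin B V"
    "\<And>W p. openin (prod_topology A B) W \<Longrightarrow> p \<in> W \<Longrightarrow> \<exists>(U, V)\<in>\<R>. p \<in> U \<times> V \<and> U \<times> V \<subseteq> W"
    using openin_prod_countable_Union[OF assms] by blast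
  show ?thesis
    unfolding second_countable_def
  proof (intro exI conjI)
    show "countable ((\<lambda>(U, V). U \<times> V) ` \<R>)"
      using \<R>(1) by simp
    show "\<forall>W\<in>(\<lambda>(U, V). U \<times> V) ` \<R>. openin (prod_topology A B) W"
      using \<R>(2) by (auto simp: openin_prod_Times_iff)
    show "\<forall>W p. openin (prod_topology A B) W \<and> p \<in> W \<longrightarrow> (\<exists>V\<in>(\<lambda>(U, V). U \<times> V) ` \<R>. p \<in> V \<and> V \<subseteq> W)"
    proof (intro allI impI)
      fix W p assume "openin (prod_topology A B) W \<and> p \<in> W"
      then obtain R where "R \<in> \<R>" "p \<in> fst R \<times> snd R" "fst R \<times> snd R \<subseteq> W"
        using \<R>(3)[of W p] by (auto simp: case_prod_unfold)
      then show "\<exists>V\<in>(\<lambda>(U, V). U \<times> V) ` \<R>. p \<in> V \<and> V \<subseteq> W"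
        by (intro bexI[of _ "fst R \<times> snd R"]) (auto simp: case_prod_unfold)
    qed
  qed
qed

text \<open>One inclusion holds because the projections are continuous. For the other, second
  countability makes every open set a countable union of open rectangles.\<close>

lemma sets_borel_of_prod_topology:
  assumes "second_countable A" "second_countable B"
  shows "sets (borel_of A \<Otimes>\<^sub>M borel_of B) = sets (borel_of (prod_topology A B))"
proof
  have "fst \<in> measurable (borel_of (prod_topology A B)) (borel_of A)"
    "snd \<in> measurable (borel_of (prod_topology A B)) (borel_of B)"
    by (auto intro!: continuous_map_measurable continuous_map_fst continuous_map_snd)
  then have "(\<lambda>p. (fst p, snd p)) \<in> measurable (borel_of (prod_topology A B)) (borel_of A \<Otimes>\<^sub>M borel_of B)"
    by (rule measurable_Pair)
  then have id: "(\<lambda>p. p) \<in> measurable (borel_of (prod_topology A B)) (borel_of A \<Otimes>\<^sub>M borel_of B)"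
    by simp
  show "sets (borel_of A \<Otimes>\<^sub>M borel_of B) \<subseteq> sets (borel_of (prod_topology A B))"
  proof
    fix D assume D: "D \<in> sets (borel_of A \<Otimes>\<^sub>M borel_of B)"
    then have "D \<subseteq> topspace A \<times> topspace B"
      using sets.sets_into_space by (fastforce simp: space_pair_measure space_borel_of)
    then show "D \<in> sets (borel_of (prod_topology A B))"
      using measurable_sets[OF id D] by (simp add: space_borel_of Int_absorb2)
  qed
next
  obtain \<R> where \<R>: "countable \<R>" "\<And>U V. (U, V) \<in> \<R> \<Longrightarrow> openin A U \<and> openin B V"
    "\<And>W p. openin (prod_topology A B) W \<Longrightarrow> p \<in> W \<Longrightarrow> \<exists>(U, V)\<in>\<R>. p \<in> U \<times> V \<and> U \<times> V \<subseteq> W"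
    using openin_prod_countable_Union[OF assms] by blast
  have "W \<in> sets (borel_of A \<Otimes>\<^sub>M borel_of B)" if W: "openin (prod_topology A B) W" for W
  proof -
    have "W = (\<Union>(U, V)\<in>{(U, V)\<in>\<R>. U \<times> V \<subseteq> W}. U \<times> V)"
      using \<R>(3)[OF W] by fastforce
    moreover have "\<dots> \<in> sets (borel_of A \<Otimes>\<^sub>M borel_of B)"
    proof (rule sets.countable_UN'')
      show "countable {(U, V)\<in>\<R>. U \<times> V \<subseteq> W}"
        by (rule countable_subset[OF _ \<R>(1)]) auto
      show "(case p of (U, V) \<Rightarrow> U \<times> V) \<in> sets (borel_of A \<Otimes>\<^sub>M borel_of B)"
        if "p \<in> {(U, V)\<in>\<R>. U \<times> V \<subseteq> W}" for p
        using that \<R>(2) by (auto intro!: pair_measureI simp: sets_borel_of)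
    qed
    ultimately show ?thesis
      by simp
  qed
  moreover have "space (borel_of A \<Otimes>\<^sub>M borel_of B) = topspace (prod_topology A B)"
    by (simp add: space_pair_measure space_borel_of)
  ultimately show "sets (borel_of (prod_topology A B)) \<subseteq> sets (borel_of A \<Otimes>\<^sub>M borel_of B)"
    unfolding sets_borel_of[of "prod_topology A B"]
    using sets.sigma_sets_subset[of "{W. openin (prod_topology A B) W}" "borel_of A \<Otimes>\<^sub>M borel_of B"]
    by auto
qed

section \<open>Embeddability is an analytic quasi-order\<close>

lemma preorder_on_qdl_embeddable: "preorder_on (space X_Qdl) qdl_embeddable"
proof -
  have "quandle_embedding UNIV p UNIV p id" for p :: "nat \<Rightarrow> nat \<Rightarrow> nat"
    by (simp add: quandle_embedding_def)
  moreover have "quandle_embedding UNIV p UNIV r (\<eta> \<circ> \<theta>)"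
    if "quandle_embedding UNIV p UNIV q \<theta>" "quandle_embedding UNIV q UNIV r \<eta>"
    for p q r :: "nat \<Rightarrow> nat \<Rightarrow> nat" and \<theta> \<eta>
    using that by (auto simp: quandle_embedding_def intro: inj_compose)
  ultimately show ?thesis
    unfolding preorder_on_def refl_on_def trans_def qdl_embeddable_def by (simp; blast)
qed

text \<open>One sequence codes two operations, under the tags 0 and 1, and a map, under the tag 2.
  The sequences that code an embedding between quandles form a G-delta subset of the Baire space,
  and the relation is its image under the continuous map that reads off the two operations.\<close>

lemma analytic_in_qdl_embeddable: "analytic_in (X_Qdl \<Otimes>\<^sub>M X_Qdl) qdl_embeddable"
proof -
  let ?X = X_Qdl_topology
  define op where "op i \<gamma> = (\<lambda>a b. \<gamma> (prod_encode (i, prod_encode (a, b))))" for i :: nat and \<gamma> :: "nat \<Rightarrow> nat"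
  define h where "h \<gamma> = (\<lambda>a. \<gamma> (prod_encode (2, a)))" for \<gamma> :: "nat \<Rightarrow> nat"
  define S where "S = {\<gamma>. quandle UNIV (op 0 \<gamma>) \<and> quandle UNIV (op 1 \<gamma>) \<and>
      quandle_embedding UNIV (op 0 \<gamma>) UNIV (op 1 \<gamma>) (h \<gamma>)}"
  have op: "continuous_on UNIV (op i)" for i
    unfolding op_def
    by (intro continuous_on_coordinatewise_then_product continuous_on_product_coordinates)
  have h: "continuous_on UNIV h"
    unfolding h_def
    by (intro continuous_on_coordinatewise_then_product continuous_on_product_coordinates)
  have emb: "quandle_embedding UNIV (op 0 \<gamma>) UNIV (op 1 \<gamma>) (h \<gamma>) \<longleftrightarrow>
      (\<forall>a b. h \<gamma> a = h \<gamma> b \<longrightarrow> a = b) \<and> (\<forall>a b. h \<gamma> (op 0 \<gamma> a b) = op 1 \<gamma> (h \<gamma> a) (h \<gamma> b))" for \<gamma>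
    by (auto simp: quandle_embedding_def inj_def)
  have ap: "continuous_on UNIV (\<lambda>\<gamma>. op i \<gamma> (f \<gamma>) (g \<gamma>))"
    if "continuous_on UNIV f" "continuous_on UNIV g" for i f g
    by (rule continuous_on_apply_discrete[OF continuous_on_apply_discrete[OF op that(1)] that(2)])
  have happ: "continuous_on UNIV (\<lambda>\<gamma>. h \<gamma> (f \<gamma>))" if "continuous_on UNIV f" for f
    by (rule continuous_on_apply_discrete[OF h that])
  note c = continuous_on_const
  have "gdelta_in euclidean S"
    unfolding S_def emb
    using open_Collect_discrete2[where P = "\<lambda>u v. u = v \<longrightarrow> a = b" for a b, OF happ[OF c] happ[OF c]]
      open_Collect_discrete2[where P = "(=)", OF happ[OF ap[OF c c]] ap[OF happ[OF c] happ[OF c]]]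
    by (intro gdelta_in_Collect_conj gdelta_in_Collect_all gdelta_quandle op) (rule gdelta_in_open, assumption)+
  then have S: "polish_topology (top_of_set S)"
    by (intro polish_topology_gdelta completely_metrizable_fun completely_metrizable_discrete)
  have cont: "continuous_map (top_of_set S) (prod_topology ?X ?X) (\<lambda>\<gamma>. (op 0 \<gamma>, op 1 \<gamma>))"
    unfolding X_Qdl_topology_eq continuous_map_pairwise o_def
    using op by (auto simp: S_def continuous_map_in_subtopology intro: continuous_on_subset)
  have "\<exists>\<gamma>\<in>S. p = op 0 \<gamma> \<and> q = op 1 \<gamma>" if pq: "(p, q) \<in> qdl_embeddable" for p q
  proof -
    obtain \<theta> where \<theta>: "quandle UNIV p" "quandle UNIV q" "quandle_embedding UNIV p UNIV q \<theta>"
      using pq by (auto simp: qdl_embeddable_def space_X_Qdl)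
    define \<gamma> where "\<gamma> n = (case prod_decode n of (i, m) \<Rightarrow>
        if i = 2 then \<theta> m else (case prod_decode m of (a, b) \<Rightarrow> if i = 0 then p a b else q a b))" for n
    have "op 0 \<gamma> = p" "op 1 \<gamma> = q" "h \<gamma> = \<theta>"
      by (simp_all add: op_def h_def \<gamma>_def)
    with \<theta> show ?thesis
      by (auto simp: S_def)
  qed
  moreover have "(op 0 \<gamma>, op 1 \<gamma>) \<in> qdl_embeddable" if "\<gamma> \<in> S" for \<gamma>
    using that by (auto simp: S_def qdl_embeddable_def space_X_Qdl)
  ultimately have "qdl_embeddable = (\<lambda>\<gamma>. (op 0 \<gamma>, op 1 \<gamma>)) ` topspace (top_of_set S)"
    by auto
  with S cont have "analytic_in_topology (prod_topology ?X ?X) qdl_embeddable"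
    unfolding analytic_in_topology_def by blast
  moreover have "second_countable ?X"
    unfolding X_Qdl_topology_eq by (intro second_countable_subtopology second_countable_euclidean)
  then have "sets (X_Qdl \<Otimes>\<^sub>M X_Qdl) = sets (borel_of (prod_topology ?X ?X))" "separable_space (prod_topology ?X ?X)"
    unfolding X_Qdl_def
    by (intro sets_borel_of_prod_topology second_countable_imp_separable_space second_countable_prod_topology; assumption)+
  moreover have "completely_metrizable_space (prod_topology ?X ?X)"
    using polish_topology_X_Qdl by (simp add: polish_topology_def completely_metrizable_space_prod_topology)
  ultimately show ?thesis
    unfolding analytic_in_def polish_topology_def by blast
qed

section \<open>Souslin sets\<close>

text \<open>This is the projection form of the Souslin operation on closed sets; the coding digraph
  needs exactly such a closed set.\<close>

definition souslin :: "'x::topological_space set \<Rightarrow> bool" where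
  "souslin A \<longleftrightarrow> (\<exists>C :: ('x \<times> (nat \<Rightarrow> nat)) set. closed C \<and> A = fst ` C)"

lemma souslinI:
  fixes C :: "('x::topological_space \<times> (nat \<Rightarrow> nat)) set"
  assumes "closed C" and "\<And>x. x \<in> A \<longleftrightarrow> (\<exists>c. (x, c) \<in> C)"
  shows "souslin A"
  unfolding souslin_def using assms by (intro exI[of _ C]) force

lemma souslinE:
  assumes "souslin A"
  obtains C :: "('x::topological_space \<times> (nat \<Rightarrow> nat)) set"
  where "closed C" and "\<And>x. x \<in> A \<longleftrightarrow> (\<exists>c. (x, c) \<in> C)"
proof -
  obtain C :: "('x \<times> (nat \<Rightarrow> nat)) set" where C: "closed C" "A = fst ` C"
    using assms by (auto simp: souslin_def)
  then have "x \<in> A \<longleftrightarrow> (\<exists>c. (x, c) \<in> C)" for x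
    by force
  with C(1) show thesis
    by (rule that)
qed

lemma closed_Collect_discrete:
  fixes f :: "'a::topological_space \<Rightarrow> 'b::discrete_topology"
  assumes "continuous_on UNIV f"
  shows "closed {x. P (f x)}"
  using open_Collect_discrete[OF assms, of "\<lambda>u. \<not> P u"] by (simp add: closed_def Collect_neg_eq)

lemma continuous_on_snd_apply:
  "continuous_on UNIV (\<lambda>p :: 'x::topological_space \<times> ('i \<Rightarrow> 'c::topological_space). snd p i)"
  by (rule continuous_on_product_then_coordinatewise[OF continuous_on_snd[OF continuous_on_id]])

lemma continuous_on_reindex:
  "continuous_on UNIV (\<lambda>p :: 'x::topological_space \<times> ('i \<Rightarrow> 'c::topological_space). (fst p, \<lambda>j. snd p (h j)))"
  by (intro continuous_on_Pair continuous_on_fst continuous_on_id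
      continuous_on_coordinatewise_then_product[OF continuous_on_snd_apply])

lemma souslin_closed:
  assumes "closed A"
  shows "souslin A"
proof (rule souslinI)
  show "closed (fst -` A :: ('a \<times> (nat \<Rightarrow> nat)) set)"
    using assms by (rule closed_vimage_fst)
qed auto

text \<open>The first entry of a witness names the index \<open>k\<close>, and the shifted rest is a
  witness for \<open>A k\<close>.\<close>

lemma souslin_UN:
  fixes A :: "nat \<Rightarrow> 'x::topological_space set"
  assumes "\<And>k. souslin (A k)"
  shows "souslin (\<Union>k. A k)"
proof -
  have "\<exists>C :: ('x \<times> (nat \<Rightarrow> nat)) set. closed C \<and> (\<forall>x. x \<in> A k \<longleftrightarrow> (\<exists>c. (x, c) \<in> C))" for k
    using assms[of k] by (rule souslinE) blast
  then obtain C :: "nat \<Rightarrow> ('x \<times> (nat \<Rightarrow> nat)) set"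
    where C: "\<And>k. closed (C k)" "\<And>k x. x \<in> A k \<longleftrightarrow> (\<exists>c. (x, c) \<in> C k)"
    by metis
  let ?r = "\<lambda>p :: 'x \<times> (nat \<Rightarrow> nat). (fst p, \<lambda>j. snd p (Suc j))"
  show ?thesis
  proof (rule souslinI)
    \<comment> \<open>Writing the choice of \<open>k\<close> as an implication turns the union into
      an intersection of closed sets, since \<open>snd p 0 \<noteq> k\<close> is a clopen
      condition.\<close>
    show "closed (\<Inter>k. {p. snd p 0 \<noteq> k} \<union> ?r -` C k)"
      by (intro closed_INT ballI closed_Un closed_Collect_discrete[OF continuous_on_snd_apply]
          closed_vimage[OF C(1) continuous_on_reindex])
    fix x
    show "x \<in> (\<Union>k. A k) \<longleftrightarrow> (\<exists>c. (x, c) \<in> (\<Inter>k. {p. snd p 0 \<noteq> k} \<union> ?r -` C k))"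
    proof
      assume "x \<in> (\<Union>k. A k)"
      then obtain k c where "(x, c) \<in> C k"
        using C(2) by auto
      then show "\<exists>c. (x, c) \<in> (\<Inter>k. {p. snd p 0 \<noteq> k} \<union> ?r -` C k)"
        by (intro exI[of _ "case_nat k c"]) auto
    qed (use C(2) in auto)
  qed
qed

text \<open>A single sequence holds one witness for each \<open>k\<close>, interleaved by the
  pairing function.\<close>

lemma souslin_INT:
  fixes A :: "nat \<Rightarrow> 'x::topological_space set"
  assumes "\<And>k. souslin (A k)"
  shows "souslin (\<Inter>k. A k)"
proof -
  have "\<exists>C :: ('x \<times> (nat \<Rightarrow> nat)) set. closed C \<and> (\<forall>x. x \<in> A k \<longleftrightarrow> (\<exists>c. (x, c) \<in> C))" for k
    using assms[of k] by (rule souslinE) blast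
  then obtain C :: "nat \<Rightarrow> ('x \<times> (nat \<Rightarrow> nat)) set"
    where C: "\<And>k. closed (C k)" "\<And>k x. x \<in> A k \<longleftrightarrow> (\<exists>c. (x, c) \<in> C k)"
    by metis
  let ?r = "\<lambda>k. \<lambda>p :: 'x \<times> (nat \<Rightarrow> nat). (fst p, \<lambda>j. snd p (prod_encode (k, j)))"
  show ?thesis
  proof (rule souslinI)
    show "closed (\<Inter>k. ?r k -` C k)"
      by (intro closed_INT ballI closed_vimage[OF C(1) continuous_on_reindex])
    fix x
    show "x \<in> (\<Inter>k. A k) \<longleftrightarrow> (\<exists>c. (x, c) \<in> (\<Inter>k. ?r k -` C k))"
    proof
      assume "x \<in> (\<Inter>k. A k)"
      then obtain c where "\<And>k. (x, c k) \<in> C k"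
        using C(2) by simp metis
      then show "\<exists>c. (x, c) \<in> (\<Inter>k. ?r k -` C k)"
        by (intro exI[of _ "\<lambda>n. case prod_decode n of (k, j) \<Rightarrow> c k j"]) simp
    qed (use C(2) in auto)
  qed
qed

lemma souslin_Int:
  assumes "souslin A" "souslin B"
  shows "souslin (A \<inter> B)"
proof -
  have "A \<inter> B = (\<Inter>k. if k = (0::nat) then A else B)"
    by (auto split: if_splits)
  then show ?thesis
    using souslin_INT[of "\<lambda>k. if k = 0 then A else B"] assms by simp
qed

lemma souslin_vimage:
  fixes f :: "'x::topological_space \<Rightarrow> 'y::topological_space"
  assumes "souslin A" and f: "continuous_on UNIV f"
  shows "souslin (f -` A)"
proof -
  obtain C :: "('y \<times> (nat \<Rightarrow> nat)) set" where C: "closed C" "\<And>x. x \<in> A \<longleftrightarrow> (\<exists>c. (x, c) \<in> C)"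
    using assms(1) by (rule souslinE) blast
  show ?thesis
  proof (rule souslinI)
    have "continuous_on UNIV (\<lambda>p :: 'x \<times> (nat \<Rightarrow> nat). (f (fst p), snd p))"
      by (intro continuous_on_Pair continuous_on_snd continuous_on_id
          continuous_on_compose2[OF f continuous_on_fst[OF continuous_on_id]]) simp
    then show "closed ((\<lambda>p. (f (fst p), snd p)) -` C)"
      by (rule closed_vimage[OF C(1)])
  qed (use C(2) in auto)
qed

text \<open>The even entries of the new witness hold the projected coordinate, the odd ones the old
  witness.\<close>

lemma souslin_projection:
  fixes A :: "('x::topological_space \<times> (nat \<Rightarrow> nat)) set"
  assumes "souslin A"
  shows "souslin (fst ` A)"
proof -
  obtain C :: "(('x \<times> (nat \<Rightarrow> nat)) \<times> (nat \<Rightarrow> nat)) set" where C: "closed C" "\<And>x. x \<in> A \<longleftrightarrow> (\<exists>c. (x, c) \<in> C)"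
    using assms by (rule souslinE) blast
  let ?r = "\<lambda>p :: 'x \<times> (nat \<Rightarrow> nat). ((fst p, \<lambda>j. snd p (2 * j)), \<lambda>j. snd p (Suc (2 * j)))"
  show ?thesis
  proof (rule souslinI)
    have "continuous_on UNIV ?r"
      by (intro continuous_on_Pair continuous_on_reindex
          continuous_on_coordinatewise_then_product[OF continuous_on_snd_apply])
    then show "closed (?r -` C)"
      by (rule closed_vimage[OF C(1)])
    fix x
    show "x \<in> fst ` A \<longleftrightarrow> (\<exists>c. (x, c) \<in> ?r -` C)"
    proof
      assume "x \<in> fst ` A"
      then obtain b c where "((x, b), c) \<in> C"
        using C(2) by auto
      then show "\<exists>c. (x, c) \<in> ?r -` C"
        by (intro exI[of _ "\<lambda>n. if even n then b (n div 2) else c (n div 2)"]) simp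
    next
      assume "\<exists>c. (x, c) \<in> ?r -` C"
      then obtain c where "((x, \<lambda>j. c (2 * j)), \<lambda>j. c (Suc (2 * j))) \<in> C"
        by auto
      then have "(x, \<lambda>j. c (2 * j)) \<in> A"
        using C(2) by blast
      then show "x \<in> fst ` A"
        by (rule image_eqI[rotated]) simp
    qed
  qed
qed

section \<open>Coding Polish spaces by sequences\<close>

text \<open>The sequence enumerates a countable dense set. In an empty space its values are
  arbitrary, whence the condition on its range.\<close>

lemma polish_topology_obtain_metric:
  assumes "polish_topology T"
  obtains M d and e :: "nat \<Rightarrow> 'a" where "Metric_space M d" "Metric_space.mcomplete M d"
    "T = Metric_space.mtopology M d" "M \<noteq> {} \<Longrightarrow> range e \<subseteq> M"
    "\<And>x r. x \<in> M \<Longrightarrow> 0 < r \<Longrightarrow> \<exists>j. d (e j) x < (r::real)"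
proof -
  obtain M d where Md: "Metric_space M d" "Metric_space.mcomplete M d" "T = Metric_space.mtopology M d"
    using assms by (auto simp: polish_topology_def completely_metrizable_space_def)
  interpret Metric_space M d by (rule Md)
  obtain D where D: "countable D" "D \<subseteq> M" "mtopology closure_of D = M"
    using assms by (auto simp: polish_topology_def separable_space_def Md(3))
  have near: "\<exists>y\<in>D. d y x < r" if x: "x \<in> M" and r: "0 < r" for x r
  proof -
    have "x \<in> mtopology closure_of D"
      using x D(3) by simp
    then have "\<exists>y. y \<in> D \<and> y \<in> U" if "x \<in> U" "openin mtopology U" for U
      using that by (simp add: in_closure_of)
    from this[OF _ openin_mball, of x r] obtain y where "y \<in> D" "y \<in> mball x r"
      using x r by auto
    then show ?thesis
      by (auto simp: commute)
  qed
  show thesis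
  proof (rule that[OF Md, of "from_nat_into D"])
    show "range (from_nat_into D) \<subseteq> M" if "M \<noteq> {}"
    proof -
      obtain x where "x \<in> M"
        using \<open>M \<noteq> {}\<close> by auto
      then have "D \<noteq> {}"
        using near[of x 1] by auto
      from subset_trans[OF range_from_nat_into_subset[OF this] D(2)] show ?thesis .
    qed
    show "\<exists>j. d (from_nat_into D j) x < r" if xr: "x \<in> M" "0 < r" for x r
    proof -
      obtain y where "y \<in> D" "d y x < r"
        using near[OF xr] by auto
      then show ?thesis
        using from_nat_into_surj[OF D(1)] by auto
    qed
  qed
qed

text \<open>A point is coded by a fast Cauchy sequence of points of a countable dense set.\<close>

lemma polish_topology_coding:
  assumes "polish_topology T" and "topspace T \<noteq> {}"
  obtains Z :: "(nat \<Rightarrow> nat) set" and \<pi> where "closed Z" and "\<pi> ` Z = topspace T"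
    and "\<And>U. openin T U \<Longrightarrow> \<exists>P. {z \<in> Z. \<pi> z \<in> U} = {z \<in> Z. \<exists>k. P k (z k)}"
proof -
  obtain M d e where Md: "Metric_space M d" "Metric_space.mcomplete M d" "T = Metric_space.mtopology M d"
    and e': "M \<noteq> {} \<Longrightarrow> range e \<subseteq> M" and dense: "\<And>x r. x \<in> M \<Longrightarrow> 0 < r \<Longrightarrow> \<exists>j :: nat. d (e j) x < r"
    using assms(1) by (rule polish_topology_obtain_metric) blast
  interpret Metric_space M d by (rule Md)
  have e: "e j \<in> M" for j
    using e' assms(2) by (auto simp: Md(3))
  define Z where "Z = {z. \<forall>k. d (e (z k)) (e (z (Suc k))) < (1/2)^k}"
  \<comment> \<open>The condition depends on two entries of \<open>z\<close> only, so it is clopen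
    despite the strict inequality.\<close>
  have "closed {z. d (e (z k)) (e (z (Suc k))) < (1/2)^k}" for k
    using open_Collect_discrete2[of "\<lambda>z. z k" "\<lambda>z. z (Suc k)" "\<lambda>u v. \<not> d (e u) (e v) < (1/2)^k"]
    by (simp add: closed_def Collect_neg_eq continuous_on_product_coordinates)
  then have "closed Z"
    unfolding Z_def by (rule closed_Collect_all)
  \<comment> \<open>The bound is the geometric sum of the \<open>m\<close> terms from
    \<open>(1/2)^k\<close> on, in closed form for the induction.\<close>
  have tail: "d (e (z k)) (e (z (k + m))) \<le> 2 * (1/2)^k - 2 * (1/2)^(k + m)" if "z \<in> Z" for z k m
  proof (induction m)
    case (Suc m)
    have "d (e (z k)) (e (z (k + Suc m))) \<le> d (e (z k)) (e (z (k + m))) + d (e (z (k + m))) (e (z (Suc (k + m))))"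
      using triangle[OF e e e] by simp
    also have "d (e (z (k + m))) (e (z (Suc (k + m)))) < (1/2)^(k + m)"
      using that by (auto simp: Z_def)
    finally show ?case
      using Suc by simp
  qed (simp add: e)
  have small: "\<exists>k. 4 * (1/2)^k < (r::real)" if "0 < r" for r
    using real_arch_pow_inv[of "r / 4" "1/2"] that by (auto simp: field_simps)
  have "\<exists>x\<in>M. \<forall>k. d (e (z k)) x \<le> 2 * (1/2)^k" if z: "z \<in> Z" for z
  proof -
    have "MCauchy (\<lambda>k. e (z k))"
      unfolding MCauchy_def
    proof (intro conjI allI impI)
      fix \<epsilon> :: real assume "0 < \<epsilon>"
      then obtain N where N: "4 * (1/2)^N < \<epsilon>"
        using small by blast
      have "d (e (z N)) (e (z n)) \<le> 2 * (1/2)^N" if "N \<le> n" for n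
      proof -
        have "d (e (z N)) (e (z (N + (n - N)))) \<le> 2 * (1/2)^N - 2 * (1/2)^(N + (n - N))"
          by (rule tail[OF z])
        also have "\<dots> \<le> 2 * (1/2)^N"
          by simp
        finally show ?thesis
          using that by simp
      qed
      then have "d (e (z n)) (e (z n')) < \<epsilon>" if "N \<le> n" "N \<le> n'" for n n'
        using triangle''[OF e e e, of "z n" "z n'" "z N"] that N by (smt (verit))
      then show "\<exists>N. \<forall>n n'. N \<le> n \<longrightarrow> N \<le> n' \<longrightarrow> d (e (z n)) (e (z n')) < \<epsilon>"
        by blast
    qed (use e in auto)
    then obtain x where x: "limitin mtopology (\<lambda>k. e (z k)) x sequentially"
      using Md(2) unfolding mcomplete_def by blast
    then have "x \<in> M"
      using limitin_mspace by blast
    have "d (e (z k)) x \<le> 2 * (1/2)^k + \<epsilon>" if "0 < \<epsilon>" for k \<epsilon>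
    proof -
      obtain N where N: "\<And>n. N \<le> n \<Longrightarrow> d (e (z n)) x < \<epsilon>"
        using x \<open>0 < \<epsilon>\<close> unfolding limitin_metric eventually_sequentially by blast
      have "d (e (z k)) x \<le> d (e (z k)) (e (z (k + N))) + d (e (z (k + N))) x"
        by (rule triangle[OF e e \<open>x \<in> M\<close>])
      also have "d (e (z k)) (e (z (k + N))) \<le> 2 * (1/2)^k - 2 * (1/2)^(k + N)"
        by (rule tail[OF z])
      also have "\<dots> \<le> 2 * (1/2)^k"
        by simp
      finally show ?thesis
        using N[of "k + N"] by simp
    qed
    then have "d (e (z k)) x \<le> 2 * (1/2)^k" for k
      by (rule field_le_epsilon)
    with \<open>x \<in> M\<close> show ?thesis
      by blast
  qed
  then obtain \<pi> where \<pi>: "\<And>z. z \<in> Z \<Longrightarrow> \<pi> z \<in> M" "\<And>z k. z \<in> Z \<Longrightarrow> d (e (z k)) (\<pi> z) \<le> 2 * (1/2)^k"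
    by metis
  show thesis
  proof (rule that[OF \<open>closed Z\<close>])
    show "\<pi> ` Z = topspace T"
    proof
      show "topspace T \<subseteq> \<pi> ` Z"
      proof
        fix x assume "x \<in> topspace T"
        then have x: "x \<in> M"
          by (simp add: Md(3))
        \<comment> \<open>The extra factor one half leaves room: consecutive errors add up to three
          quarters of \<open>(1/2)^k\<close>.\<close>
        have "\<exists>j. d (e j) x < (1/2)^k / 2" for k
          by (rule dense[OF x]) simp
        then obtain z where z: "\<And>k. d (e (z k)) x < (1/2)^k / 2"
          by metis
        have "d (e (z k)) (e (z (Suc k))) < (1/2)^k" for k
        proof -
          have "d (e (z k)) (e (z (Suc k))) \<le> d (e (z k)) x + d (e (z (Suc k))) x"
            by (rule triangle'[OF e x e])
          also have "\<dots> < (1/2)^k / 2 + (1/2)^Suc k / 2"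
            by (intro add_strict_mono z)
          also have "\<dots> \<le> (1/2)^k"
            by simp
          finally show ?thesis .
        qed
        then have "z \<in> Z"
          by (simp add: Z_def)
        have "d (\<pi> z) x < r" if "0 < r" for r
        proof -
          obtain k where k: "4 * (1/2)^k < r"
            using small \<open>0 < r\<close> by blast
          have "d (\<pi> z) x \<le> d (e (z k)) (\<pi> z) + d (e (z k)) x"
            by (rule triangle''[OF \<pi>(1)[OF \<open>z \<in> Z\<close>] e x])
          moreover have "0 < (1/2 :: real)^k"
            by simp
          ultimately show ?thesis
            using \<pi>(2)[OF \<open>z \<in> Z\<close>, of k] z[of k] k by linarith
        qed
        then have "d (\<pi> z) x = 0"
          using nonneg[of "\<pi> z" x] by (metis less_irrefl order_le_less)
        then have "\<pi> z = x"
          using \<pi>(1)[OF \<open>z \<in> Z\<close>] x by simp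
        with \<open>z \<in> Z\<close> show "x \<in> \<pi> ` Z"
          by blast
      qed
    qed (use \<pi>(1) in \<open>auto simp: Md(3)\<close>)
  next
    fix U assume U: "openin T U"
    \<comment> \<open>Entry \<open>k\<close> alone determines the coded point up to
      \<open>4 * (1/2)^k\<close>, because both limits lie within \<open>2 * (1/2)^k\<close> of
      \<open>e (z k)\<close>. Hence open sets pull back to unions of conditions on single
      entries.\<close>
    have "\<exists>k. \<forall>w\<in>Z. w k = z k \<longrightarrow> \<pi> w \<in> U" if z: "z \<in> Z" "\<pi> z \<in> U" for z
    proof -
      obtain r where r: "0 < r" "mball (\<pi> z) r \<subseteq> U"
        using U z(2) by (auto simp: Md(3) openin_mtopology)
      obtain k where k: "4 * (1/2)^k < r"
        using small r(1) by blast
      have "\<pi> w \<in> U" if w: "w \<in> Z" "w k = z k" for w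
      proof -
        have "d (\<pi> z) (\<pi> w) \<le> d (e (z k)) (\<pi> z) + d (e (z k)) (\<pi> w)"
          by (rule triangle''[OF \<pi>(1)[OF z(1)] e \<pi>(1)[OF w(1)]])
        then have "d (\<pi> z) (\<pi> w) < r"
          using \<pi>(2)[OF z(1), of k] \<pi>(2)[OF w(1), of k] k w(2) by simp
        then show ?thesis
          using r(2) \<pi>(1) z(1) w(1) by auto
      qed
      then show ?thesis
        by blast
    qed
    then have "{z \<in> Z. \<pi> z \<in> U} = {z \<in> Z. \<exists>k. (\<lambda>k j. \<forall>w\<in>Z. w k = j \<longrightarrow> \<pi> w \<in> U) k (z k)}"
      by auto
    then show "\<exists>P. {z \<in> Z. \<pi> z \<in> U} = {z \<in> Z. \<exists>k. P k (z k)}"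
      by (rule exI[of _ "\<lambda>k j. \<forall>w\<in>Z. w k = j \<longrightarrow> \<pi> w \<in> U"])
  qed
qed

text \<open>Souslin sets are closed under countable unions and intersections but not under
  complements, so the induction carries the preimage of a Borel set together with that of its
  complement.\<close>

lemma souslin_borel_vimage:
  fixes Z :: "(nat \<Rightarrow> nat) set"
  assumes "closed Z" and \<pi>: "\<pi> ` Z = topspace T"
    and cont: "\<And>U. openin T U \<Longrightarrow> \<exists>P. {z \<in> Z. \<pi> z \<in> U} = {z \<in> Z. \<exists>k. P k (z k)}"
    and D: "D \<in> sets (borel_of T)"
  shows "souslin {z \<in> Z. \<pi> z \<in> D}"
proof -
  have "souslin {z \<in> Z. \<pi> z \<in> D} \<and> souslin {z \<in> Z. \<pi> z \<notin> D}"
    using D unfolding sets_borel_of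
  proof (induction rule: sigma_sets.induct)
    case (Basic U)
    then obtain P where P: "{z \<in> Z. \<pi> z \<in> U} = {z \<in> Z. \<exists>k. P k (z k)}"
      using cont by blast
    have clopen: "closed {z :: nat \<Rightarrow> nat. Q (z k)}" for Q k
      by (rule closed_Collect_discrete[OF continuous_on_product_coordinates])
    have "{z \<in> Z. \<pi> z \<in> U} = (\<Union>k. Z \<inter> {z. P k (z k)})"
      unfolding P by auto
    moreover have "souslin (\<Union>k. Z \<inter> {z. P k (z k)})"
      by (intro souslin_UN souslin_closed closed_Int clopen assms(1))
    moreover have "{z \<in> Z. \<pi> z \<notin> U} = Z \<inter> (\<Inter>k. {z. \<not> P k (z k)})"
      using P by blast
    moreover have "souslin (Z \<inter> (\<Inter>k. {z. \<not> P k (z k)}))"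
      by (intro souslin_closed closed_Int closed_INT ballI clopen assms(1))
    ultimately show ?case
      by simp
  next
    case Empty
    then show ?case
      using souslin_closed[OF \<open>closed Z\<close>] souslin_closed[OF closed_empty] by simp
  next
    case (Compl D)
    have "{z \<in> Z. \<pi> z \<in> topspace T - D} = {z \<in> Z. \<pi> z \<notin> D}" "{z \<in> Z. \<pi> z \<notin> topspace T - D} = {z \<in> Z. \<pi> z \<in> D}"
      using \<pi> by auto
    with Compl.IH show ?case
      by simp
  next
    case (Union D)
    have "{z \<in> Z. \<pi> z \<in> (\<Union>k. D k)} = (\<Union>k. {z \<in> Z. \<pi> z \<in> D k})" "{z \<in> Z. \<pi> z \<notin> (\<Union>k. D k)} = (\<Inter>k. {z \<in> Z. \<pi> z \<notin> D k})"
      by auto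
    with Union.IH show ?case
      by (simp add: souslin_UN souslin_INT del: INT_simps UN_simps)
  qed
  then show ?thesis
    by blast
qed

text \<open>With points replaced by their codes \<open>z\<close>, the graph of each map is Souslin:
  for every \<open>n\<close> there is an \<open>m\<close> that is the value on both sides.
  Projecting the code away keeps the image Souslin.\<close>

lemma borel_image_closed_projection:
  fixes \<phi> \<psi> :: "'s \<Rightarrow> nat \<Rightarrow> nat"
  assumes T: "polish_topology T"
    and \<phi>: "\<And>n m. {s \<in> topspace T. \<phi> s n = m} \<in> sets (borel_of T)"
    and \<psi>: "\<And>n m. {s \<in> topspace T. \<psi> s n = m} \<in> sets (borel_of T)"
  obtains C :: "((nat \<Rightarrow> nat) \<times> (nat \<Rightarrow> nat) \<times> (nat \<Rightarrow> nat)) set"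
  where "closed C" and "(\<lambda>s. (\<phi> s, \<psi> s)) ` topspace T = {(x, y). \<exists>c. (x, c, y) \<in> C}"
proof (cases "topspace T = {}")
  case True
  then show thesis
    using that[of "{}"] by simp
next
  case False
  obtain Z :: "(nat \<Rightarrow> nat) set" and \<pi> where Z: "closed Z" "\<pi> ` Z = topspace T"
    "\<And>U. openin T U \<Longrightarrow> \<exists>P. {z \<in> Z. \<pi> z \<in> U} = {z \<in> Z. \<exists>k. P k (z k)}"
    using T False by (rule polish_topology_coding) blast
  let ?A = "\<lambda>(f :: (nat \<Rightarrow> nat) \<times> (nat \<Rightarrow> nat) \<Rightarrow> nat \<Rightarrow> nat) h.
    \<Inter>n. \<Union>m. {p. f (fst p) n = m} \<inter> snd -` {z \<in> Z. h (\<pi> z) n = m}"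
  have souslin_graph: "souslin (?A f h)"
    if f: "continuous_on UNIV f" and h: "\<And>n m. {s \<in> topspace T. h s n = m} \<in> sets (borel_of T)" for f h
  proof -
    have "{z \<in> Z. h (\<pi> z) n = m} = {z \<in> Z. \<pi> z \<in> {s \<in> topspace T. h s n = m}}" for n m
      using Z(2) by auto
    then have "souslin {z \<in> Z. h (\<pi> z) n = m}" for n m
      using souslin_borel_vimage[OF Z h] by simp
    moreover have "continuous_on UNIV (\<lambda>p :: ((nat \<Rightarrow> nat) \<times> (nat \<Rightarrow> nat)) \<times> (nat \<Rightarrow> nat). f (fst p) n)" for n
      by (rule continuous_on_product_then_coordinatewise[OF
            continuous_on_compose2[OF f continuous_on_fst[OF continuous_on_id]]]) simp
    then have "souslin {p :: ((nat \<Rightarrow> nat) \<times> (nat \<Rightarrow> nat)) \<times> (nat \<Rightarrow> nat). f (fst p) n = m}" for n m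
      by (rule souslin_closed[OF closed_Collect_discrete[where P = "\<lambda>u. u = m"]])
    ultimately show ?thesis
      by (intro souslin_INT souslin_UN souslin_Int souslin_vimage[OF _ continuous_on_snd[OF continuous_on_id]])
  qed
  have "souslin (fst ` (?A fst \<phi> \<inter> ?A snd \<psi>))"
    by (intro souslin_projection souslin_Int souslin_graph \<phi> \<psi> continuous_on_fst continuous_on_snd continuous_on_id)
  then obtain C :: "(((nat \<Rightarrow> nat) \<times> (nat \<Rightarrow> nat)) \<times> (nat \<Rightarrow> nat)) set"
    where C: "closed C" "\<And>p. p \<in> fst ` (?A fst \<phi> \<inter> ?A snd \<psi>) \<longleftrightarrow> (\<exists>c. (p, c) \<in> C)"
    by (rule souslinE) blast
  \<comment> \<open>The witness moves between the two points, the order in which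
    \<open>steps\<close> reads a triple.\<close>
  let ?r = "\<lambda>q :: (nat \<Rightarrow> nat) \<times> (nat \<Rightarrow> nat) \<times> (nat \<Rightarrow> nat). ((fst q, snd (snd q)), fst (snd q))"
  have graph_iff: "(p, z) \<in> ?A f h \<longleftrightarrow> z \<in> Z \<and> f p = h (\<pi> z)" for p z f h
    by (auto simp: fun_eq_iff)
  have A: "(x, y) \<in> fst ` (?A fst \<phi> \<inter> ?A snd \<psi>) \<longleftrightarrow> (\<exists>z\<in>Z. x = \<phi> (\<pi> z) \<and> y = \<psi> (\<pi> z))" for x y
  proof
    assume "(x, y) \<in> fst ` (?A fst \<phi> \<inter> ?A snd \<psi>)"
    then obtain z where "((x, y), z) \<in> ?A fst \<phi>" "((x, y), z) \<in> ?A snd \<psi>"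
      by auto
    then show "\<exists>z\<in>Z. x = \<phi> (\<pi> z) \<and> y = \<psi> (\<pi> z)"
      unfolding graph_iff by auto
  next
    assume "\<exists>z\<in>Z. x = \<phi> (\<pi> z) \<and> y = \<psi> (\<pi> z)"
    then obtain z where "((x, y), z) \<in> ?A fst \<phi>" "((x, y), z) \<in> ?A snd \<psi>"
      unfolding graph_iff by auto
    then show "(x, y) \<in> fst ` (?A fst \<phi> \<inter> ?A snd \<psi>)"
      by (intro image_eqI[of _ _ "((x, y), z)"] IntI) simp_all
  qed
  show thesis
  proof (rule that)
    have "continuous_on UNIV ?r"
      by (intro continuous_on_Pair continuous_on_fst continuous_on_snd continuous_on_id)
    then show "closed (?r -` C)"
      by (rule closed_vimage[OF C(1)])
    have "(\<lambda>s. (\<phi> s, \<psi> s)) ` topspace T = {(x, y). \<exists>z\<in>Z. x = \<phi> (\<pi> z) \<and> y = \<psi> (\<pi> z)}"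
      using Z(2)[symmetric] by auto
    also have "\<dots> = {(x, y). \<exists>c. (x, c, y) \<in> ?r -` C}"
      using A C(2) by simp
    finally show "(\<lambda>s. (\<phi> s, \<psi> s)) ` topspace T = {(x, y). \<exists>c. (x, c, y) \<in> ?r -` C}" .
  qed
qed

text \<open>A point is sent to its membership pattern in countably many balls around a dense
  sequence; these balls are Borel and separate points.\<close>

lemma standard_borel_obtain_injection:
  assumes "standard_borel Y"
  obtains i :: "'a \<Rightarrow> nat \<Rightarrow> nat" where "inj_on i (space Y)"
    and "\<And>n. (\<lambda>y. i y n) \<in> measurable Y (count_space UNIV)"
proof -
  obtain T where T: "polish_topology T" "sets Y = sets (borel_of T)"
    using assms by (auto simp: standard_borel_def)
  obtain M d e where Md: "Metric_space M d" "T = Metric_space.mtopology M d"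
    and dense: "\<And>x r. x \<in> M \<Longrightarrow> 0 < r \<Longrightarrow> \<exists>j :: nat. d (e j) x < r"
    and e: "M \<noteq> {} \<Longrightarrow> range e \<subseteq> M"
    using T(1) by (rule polish_topology_obtain_metric) blast
  interpret Metric_space M d by (rule Md)
  have space: "space Y = M"
    using sets_eq_imp_space_eq[OF T(2)] by (simp add: space_borel_of Md(2))
  define B where "B n = (case prod_decode n of (j, k) \<Rightarrow> mball (e j) (inverse (real (Suc k))))" for n
  have B: "B n \<in> sets Y" for n
    by (auto simp: T(2) sets_borel_of B_def Md(2) split: prod.split)
  define i where "i y n = (if y \<in> B n then 1 else 0 :: nat)" for y n
  show thesis
  proof (rule that)
    show "(\<lambda>y. i y n) \<in> measurable Y (count_space UNIV)" for n
      unfolding i_def using B[of n] by measurable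
    show "inj_on i (space Y)"
    proof (rule inj_onI)
      fix x y assume xy: "x \<in> space Y" "y \<in> space Y" "i x = i y"
      show "x = y"
      proof (rule ccontr)
        assume "x \<noteq> y"
        \<comment> \<open>A ball of radius below half the distance cannot contain both
          points.\<close>
        then have "0 < d x y / 2"
          using xy by (simp add: space)
        then obtain k where k: "inverse (real (Suc k)) < d x y / 2"
          using reals_Archimedean by blast
        obtain j where j: "d (e j) x < inverse (real (Suc k))"
          using dense[of x "inverse (real (Suc k))"] xy by (auto simp: space)
        have ej: "e j \<in> M"
          using e xy by (auto simp: space)
        let ?n = "prod_encode (j, k)"
        have "x \<in> B ?n"
          using j ej xy by (simp add: B_def space)
        then have "y \<in> B ?n"
          using fun_cong[OF xy(3), of ?n] by (simp add: i_def split: if_splits)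
        then have "d (e j) y < inverse (real (Suc k))"
          by (simp add: B_def)
        moreover have "d x y \<le> d (e j) x + d (e j) y"
          using xy ej by (intro triangle'') (auto simp: space)
        ultimately show False
          using j k by simp
      qed
    qed
  qed
qed

section \<open>Completeness of embeddability of quandles\<close>

theorem theorem4p2:
  shows "standard_borel X_Qdl \<and> analytic_quasi_order_on X_Qdl qdl_embeddable \<and>
    (\<forall>(Y :: 'a measure) R. standard_borel Y \<and> analytic_quasi_order_on Y R \<longrightarrow>
       (\<exists>g. g \<in> measurable Y X_Qdl \<and>
          (\<forall>x\<in>space Y. \<forall>y\<in>space Y. (x, y) \<in> R \<longleftrightarrow> (g x, g y) \<in> qdl_embeddable)))"
proof (intro conjI allI impI)
  show "standard_borel X_Qdl"
    by (rule standard_borel_X_Qdl)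
  show "analytic_quasi_order_on X_Qdl qdl_embeddable"
    unfolding analytic_quasi_order_on_def
    using preorder_on_qdl_embeddable analytic_in_qdl_embeddable by blast
next
  fix Y :: "'a measure" and R
  assume "standard_borel Y \<and> analytic_quasi_order_on Y R"
  then have Y: "standard_borel Y" and pre: "preorder_on (space Y) R" and "analytic_in (Y \<Otimes>\<^sub>M Y) R"
    by (auto simp: analytic_quasi_order_on_def)
  have sub: "R \<subseteq> space Y \<times> space Y" and refl_R: "\<And>x. x \<in> space Y \<Longrightarrow> (x, x) \<in> R" and "trans R"
    using pre by (auto simp: preorder_on_def refl_on_def)
  obtain i :: "'a \<Rightarrow> nat \<Rightarrow> nat" where inj: "inj_on i (space Y)"
    and i: "\<And>n. (\<lambda>y. i y n) \<in> measurable Y (count_space UNIV)"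
    using standard_borel_obtain_injection[OF Y] by blast
  obtain T and S :: "(nat \<Rightarrow> nat) topology" and f where T: "sets (Y \<Otimes>\<^sub>M Y) = sets (borel_of T)"
    and S: "polish_topology S" and f: "continuous_map S T f" and R: "R = f ` topspace S"
    using \<open>analytic_in (Y \<Otimes>\<^sub>M Y) R\<close> unfolding analytic_in_def analytic_in_topology_def by blast
  \<comment> \<open>The topology on the product need not be a product topology; only its Borel sets
    matter, so continuity of \<open>f\<close> is used as measurability.\<close>
  have [measurable]: "f \<in> measurable (borel_of S) (Y \<Otimes>\<^sub>M Y)"
    using continuous_map_measurable[OF f] measurable_cong_sets[OF refl T] by blast
  have borel: "{s \<in> topspace S. i (h (f s)) n = m} \<in> sets (borel_of S)"
    if h: "h \<in> measurable (Y \<Otimes>\<^sub>M Y) Y" for h n m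
  proof -
    have "(\<lambda>s. i (h (f s)) n) \<in> measurable (borel_of S) (count_space UNIV)"
      using measurable_compose[OF measurable_compose[OF _ h] i] by measurable
    from measurable_sets[OF this, of "{m}"] show ?thesis
      by (simp add: vimage_def Int_def space_borel_of conj_commute)
  qed
  obtain C :: "((nat \<Rightarrow> nat) \<times> (nat \<Rightarrow> nat) \<times> (nat \<Rightarrow> nat)) set"
    where "closed C" and C: "(\<lambda>s. (i (fst (f s)), i (snd (f s)))) ` topspace S = {(x, y). \<exists>c. (x, c, y) \<in> C}"
    by (rule borel_image_closed_projection[OF S borel[OF measurable_fst] borel[OF measurable_snd]])
  \<comment> \<open>The relation is pushed forward along \<open>i\<close>. It is reflexive on the
    image of \<open>space Y\<close>, which is all that is asked of the points being
    compared.\<close>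
  define R' where "R' = {(x, y). \<exists>c. (x, c, y) \<in> C}"
  have R': "R' = map_prod i i ` R"
    unfolding R'_def C[symmetric] R by (auto simp: image_image map_prod_def case_prod_unfold)
  have cancel: "a = b" if "i a = i b" "a \<in> space Y" "b \<in> space Y" for a b
    using inj_onD[OF inj] that by blast
  have R'_iff: "(i x, i y) \<in> R' \<longleftrightarrow> (x, y) \<in> R" if "x \<in> space Y" "y \<in> space Y" for x y
  proof
    assume "(i x, i y) \<in> R'"
    then obtain a b where ab: "(a, b) \<in> R" "i x = i a" "i y = i b"
      by (auto simp: R')
    then have "a \<in> space Y" "b \<in> space Y"
      using sub by auto
    then have "x = a" "y = b"
      using ab(2,3) that by (simp_all add: cancel)
    with ab(1) show "(x, y) \<in> R"
      by simp
  qed (auto simp: R')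
  have "trans R'"
  proof (rule transI)
    fix x y z assume "(x, y) \<in> R'" "(y, z) \<in> R'"
    then obtain a b b' c where abc: "(a, b) \<in> R" "(b', c) \<in> R" "x = i a" "i b = i b'" "z = i c"
      by (auto simp: R')
    \<comment> \<open>The two middle points agree only after applying \<open>i\<close>; injectivity
      on \<open>space Y\<close> identifies them.\<close>
    then have "b \<in> space Y" "b' \<in> space Y"
      using sub by auto
    with abc(4) have "b = b'"
      by (rule cancel)
    with abc(1,2) have "(a, c) \<in> R"
      using \<open>trans R\<close> by (auto dest: transD)
    then show "(x, z) \<in> R'"
      by (auto simp: R' abc(3,5))
  qed
  show "\<exists>g. g \<in> measurable Y X_Qdl \<and> (\<forall>x\<in>space Y. \<forall>y\<in>space Y. (x, y) \<in> R \<longleftrightarrow> (g x, g y) \<in> qdl_embeddable)"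
  proof (intro exI conjI ballI)
    show "(\<lambda>y. coded_quandle (steps C) (i y)) \<in> measurable Y X_Qdl"
      by (intro measurable_X_Qdl quandle_coded_quandle coded_quandle_measurable i)
    fix x y assume "x \<in> space Y" "y \<in> space Y"
    then show "(x, y) \<in> R \<longleftrightarrow> (coded_quandle (steps C) (i x), coded_quandle (steps C) (i y)) \<in> qdl_embeddable"
      using coded_quandle_embeddable_iff[OF \<open>closed C\<close> R'_def \<open>trans R'\<close>, of "i x" "i y"] R'_iff refl_R by simp
  qed
qed

end
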